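(* Consider the KL control problem $$\min_{\{Q_{U_t|X_t}\}_{t=0}^{T-1}}\;\mathbb E_Q^{x_0}\Big[\sum_{t=0}^{T-1}C_t(X_t,U_t)+C_T(X_T)\Big]+\lambda D\big(Q_{X_{0:T},U_{0:T-1}}\|R_{X_{0:T},U_{0:T-1}}\big)$$ with deterministic state transition $x_{t+1}=A_tx_t+B_tu_t$, reference policy $R_{U_t|X_t}(u_t|x_t)=\mathcal N(0,\hat\Omega_t)$, and costs $C_t(x_t,u_t)=\frac12x_t^\top M_tx_t$ for $t=0,\dots,T-1$ and $C_T(x_T)=\frac12x_T^\top M_Tx_T$, where $N_t=\lambda\hat\Omega_t^{-1}$ and $B_t\hat\Omega_tB_t^\top=\Omega_t$ for $t=0,\dots,T-1$. This problem admits the optimal policy $$Q^*_{U_t|X_t}(u_t|x_t)=\mathcal N\left(-\hat H_t^{-1}\hat G_t^\top x_t,\ \lambda\hat H_t^{-1}\right),$$ where $\hat G_t=A_t^\top\hat\Theta_{t+1}B_t$, $\hat H_t=B_t^\top\hat\Theta_{t+1}B_t+\lambda\hat\Omega_t^{-1}$, and $\hat\Theta_t$ is the solution of the Riccati difference equation $$\hat\Theta_t=A_t^\top\hat\Theta_{t+1}A_t+M_t-A_t^\top\hat\Theta_{t+1}B_t\left(B_t^\top\hat\Theta_{t+1}B_t+\lambda\hat\Omega_t^{-1}\right)^{-1}B_t^\top\hat\Theta_{t+1}A_t,\qquad\hat\Theta_T=M_T .$$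
   Context: States $x_t\in\mathbb R^n$, controls $u_t\in\mathbb R^m$, times $0,\dots,T$, known initial state $x_0$. $\lambda>0$ and $\hat\Omega_t\succ0$. $\{M_t\}_{t=0}^T$ and $\{N_t\}_{t=0}^{T-1}$ are sequences of positive definite matrices and $\Omega_t$ is the covariance of the noise $W_t$ in an associated linear-quadratic problem with dynamics $X_{t+1}=A_tX_t+B_tU_t+W_t$ (the objects $N_t,\Omega_t$ enter only through the stated relations). Policies $Q_{U_t|X_t}$ are stochastic kernels on the control space given the state. $Q_{X_{0:T},U_{0:T-1}}$ and $R_{X_{0:T},U_{0:T-1}}$ are the joint laws of state-control trajectories induced by the policies $Q$ and $R$ together with the state transition; $\mathbb E_Q^{x_0}$ is expectation under the former with initial state $x_0$. $D(Q\|R)=\int\log\frac{dQ}{dR}dQ$ is the Kullback-Leibler divergence. $\mathcal N(\mu,\Sigma)$ is the Gaussian law with mean $\mu$ and covariance $\Sigma$. *)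

theory Defs
  imports "HOL-Probability.Probability"
begin

definition pos_def :: "real ^ 'k ^ 'k \<Rightarrow> bool" where
  "pos_def S \<longleftrightarrow> transpose S = S \<and> (\<forall>x. x \<noteq> 0 \<longrightarrow> 0 < x \<bullet> (S *v x))"

(* The law N(mu, S) through its Lebesgue density; only meaningful for positive definite S. *)
definition gaussian :: "real ^ 'k \<Rightarrow> real ^ 'k ^ 'k \<Rightarrow> (real ^ 'k) measure" where
  "gaussian \<mu> S = density lborel (\<lambda>u. ennreal
     (exp (- (1/2) * ((u - \<mu>) \<bullet> (matrix_inv S *v (u - \<mu>)))) /
      sqrt ((2 * pi) ^ CARD('k) * det S)))"

(* Q t x is the conditional law of U_t given X_t = x; only the times t < T matter. *)
definition policies :: "nat \<Rightarrow> (nat \<Rightarrow> real ^ 'n \<Rightarrow> (real ^ 'm) measure) set" where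
  "policies T = {Q. \<forall>t<T. Q t \<in> borel \<rightarrow>\<^sub>M prob_algebra borel}"

(* Trajectories (X_{0:T}, U_{0:T-1}). *)
definition traj_space ::
  "nat \<Rightarrow> ((nat \<Rightarrow> real ^ 'n) \<times> (nat \<Rightarrow> real ^ 'm)) measure" where
  "traj_space T = (\<Pi>\<^sub>M t\<in>{..T}. borel) \<Otimes>\<^sub>M (\<Pi>\<^sub>M t\<in>{..<T}. borel)"

(* Joint law of the trajectory under X_0 = x0, U_t ~ Q t X_t, X_(t+1) = f t X_t U_t:
   the recursion draws v = U_t and appends v and the successor state. *)
primrec traj_law ::
  "(nat \<Rightarrow> real ^ 'n \<Rightarrow> real ^ 'm \<Rightarrow> real ^ 'n) \<Rightarrow> real ^ 'n \<Rightarrow>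
   (nat \<Rightarrow> real ^ 'n \<Rightarrow> (real ^ 'm) measure) \<Rightarrow> nat \<Rightarrow>
   ((nat \<Rightarrow> real ^ 'n) \<times> (nat \<Rightarrow> real ^ 'm)) measure" where
  "traj_law f x0 Q 0 = return (traj_space 0) (\<lambda>t\<in>{..0}. x0, \<lambda>t\<in>{..<0}. undefined)"
| "traj_law f x0 Q (Suc t) = traj_law f x0 Q t \<bind>
     (\<lambda>(x, u). distr (Q t (x t)) (traj_space (Suc t))
        (\<lambda>v. (x(Suc t := f t (x t) v), u(t := v))))"

(* Expectation with values in [-oo, oo]; a non-integrable nonnegative cost gets oo, not 0. *)
definition ext_expectation :: "'a measure \<Rightarrow> ('a \<Rightarrow> real) \<Rightarrow> ereal" where
  "ext_expectation P g =
     enn2ereal (\<integral>\<^sup>+\<omega>. ennreal (g \<omega>) \<partial>P) - enn2ereal (\<integral>\<^sup>+\<omega>. ennreal (- g \<omega>) \<partial>P)"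

(* D(Q || R) with natural logarithm; note the argument order of KL_divergence.
   It is oo if Q is not absolutely continuous with respect to R. For probability measures the
   negative part of log (dQ/dR) is always Q-integrable, so non-integrability also means oo. *)
definition KL_div :: "'a measure \<Rightarrow> 'a measure \<Rightarrow> ereal" where
  "KL_div Q R =
     (if absolutely_continuous R Q \<and> integrable Q (entropy_density (exp 1) R Q)
      then ereal (KL_divergence (exp 1) R Q) else \<infinity>)"

definition KL_control_objective ::
  "real \<Rightarrow> (nat \<Rightarrow> real ^ 'n \<Rightarrow> real ^ 'm \<Rightarrow> real ^ 'n) \<Rightarrow>
   (nat \<Rightarrow> real ^ 'n \<Rightarrow> real ^ 'm \<Rightarrow> real) \<Rightarrow> (real ^ 'n \<Rightarrow> real) \<Rightarrow>
   (nat \<Rightarrow> real ^ 'n \<Rightarrow> (real ^ 'm) measure) \<Rightarrow> real ^ 'n \<Rightarrow> nat \<Rightarrow>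
   (nat \<Rightarrow> real ^ 'n \<Rightarrow> (real ^ 'm) measure) \<Rightarrow> ereal" where
  "KL_control_objective lam f C CT R x0 T Q =
     ext_expectation (traj_law f x0 Q T) (\<lambda>(x, u). (\<Sum>t<T. C t (x t) (u t)) + CT (x T))
     + ereal lam * KL_div (traj_law f x0 Q T) (traj_law f x0 R T)"

definition KL_control_optimal ::
  "real \<Rightarrow> (nat \<Rightarrow> real ^ 'n \<Rightarrow> real ^ 'm \<Rightarrow> real ^ 'n) \<Rightarrow>
   (nat \<Rightarrow> real ^ 'n \<Rightarrow> real ^ 'm \<Rightarrow> real) \<Rightarrow> (real ^ 'n \<Rightarrow> real) \<Rightarrow>
   (nat \<Rightarrow> real ^ 'n \<Rightarrow> (real ^ 'm) measure) \<Rightarrow> real ^ 'n \<Rightarrow> nat \<Rightarrow>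
   (nat \<Rightarrow> real ^ 'n \<Rightarrow> (real ^ 'm) measure) \<Rightarrow> bool" where
  "KL_control_optimal lam f C CT R x0 T Qs \<longleftrightarrow>
     Qs \<in> policies T \<and>
     (\<forall>Q\<in>policies T. KL_control_objective lam f C CT R x0 T Qs
                     \<le> KL_control_objective lam f C CT R x0 T Q)"

end

(* By the Gibbs (Donsker--Varadhan) variational principle the objective, even over arbitrary
   laws of the trajectory, is minimised by exp ((c - Phi) / lambda) dR, where R is the reference
   law, Phi is the total cost and c normalises. It remains to see that Q* induces exactly this
   law. This follows step by step: completing the square with the Riccati recursion shows that
   Q*_t has density exp ((V_t(x) - C_t(x) - V_(t+1)(A_t x + B_t u)) / lambda) with respect to R_t,
   where V_t(x) = x \<bullet> Theta_t x / 2 + const, and the exponents telescope. *)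

theory Submission
  imports Defs
begin

section \<open>Linear change of variables\<close>

text \<open>Since the transition is deterministic, trajectory laws are concentrated on the graph of
  the dynamics and have no Lebesgue density. Every density is therefore taken relative to the law of
  the reference policy: there the transition cancels and only the control kernels are compared. The
  normalisation of the Gibbs weight comes from its being the law of an actual policy, and the
  constant c is then V_0(x_0), the optimal value. This rests on the Gaussian formulas having total
  mass one, which is where determinants and linear substitution enter; the constant in V_t collects
  \<lambda> times the logarithms of the quotients of the two normalising factors at times t to T -
  1. For the formulas to be Gaussian at all, \<open>H t\<close> must be positive definite, which
  depends on \<Theta> at the next time being positive semidefinite; this invariant is carried
  backwards from \<open>M T\<close>. Costs are nonnegative, so the objective never becomes a
  difference of infinities, and competitors with infinite cost or divergence can be split off before
  real integrals are compared.\<close>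

lemma nn_integral_lborel_shear:
  fixes b :: "'a::euclidean_space" and h :: "'a \<Rightarrow> real"
  assumes b: "b \<in> Basis" and [measurable]: "g \<in> borel_measurable borel" "h \<in> borel_measurable borel"
    and h: "\<And>x t. h (x + t *\<^sub>R b) = h x"
  shows "(\<integral>\<^sup>+x. g (x + h x *\<^sub>R b) \<partial>lborel) = (\<integral>\<^sup>+x. g x \<partial>lborel)"
proof -
  interpret product_sigma_finite "\<lambda>_::'a. lborel :: real measure" ..
  define e where "e f = (\<Sum>c\<in>Basis - {b}. f c *\<^sub>R c)" for f :: "'a \<Rightarrow> real"
  have B: "(Basis :: 'a set) = insert b (Basis - {b})" using b by auto
  \<comment> \<open>The coordinate along \<open>b\<close> is integrated innermost. There
    \<open>h\<close> is constant, because it does not change along \<open>b\<close>, so the shear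
    acts on that coordinate as a translation.\<close>
  have fubini: "(\<integral>\<^sup>+x. k x \<partial>lborel) =
      (\<integral>\<^sup>+f. (\<integral>\<^sup>+y. k (e f + y *\<^sub>R b) \<partial>lborel) \<partial>(\<Pi>\<^sub>M c\<in>Basis - {b}. lborel))"
    if [measurable]: "k \<in> borel_measurable borel" for k
  proof -
    have "(\<integral>\<^sup>+x. k x \<partial>lborel) =
        (\<integral>\<^sup>+f. k (\<Sum>c\<in>Basis. f c *\<^sub>R c) \<partial>(\<Pi>\<^sub>M c\<in>(Basis :: 'a set). lborel))"
      by (subst lborel_eq) (simp add: nn_integral_distr)
    also have "\<dots> = (\<integral>\<^sup>+f. k (\<Sum>c\<in>Basis. f c *\<^sub>R c) \<partial>(\<Pi>\<^sub>M c\<in>insert b (Basis - {b}). lborel))"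
      using B by simp
    also have "\<dots> = (\<integral>\<^sup>+f. (\<integral>\<^sup>+y. k (\<Sum>c\<in>Basis. (f(b := y)) c *\<^sub>R c) \<partial>lborel)
        \<partial>(\<Pi>\<^sub>M c\<in>Basis - {b}. lborel))"
      by (rule product_nn_integral_insert) (simp_all add: insert_absorb b)
    also have "(\<lambda>f y. k (\<Sum>c\<in>Basis. (f(b := y)) c *\<^sub>R c)) = (\<lambda>f y. k (e f + y *\<^sub>R b))"
      by (intro ext) (simp add: e_def sum.remove[OF finite_Basis b] add.commute)
    finally show ?thesis .
  qed
  have [measurable]: "e \<in> borel_measurable (\<Pi>\<^sub>M c\<in>Basis - {b}. lborel)"
    unfolding e_def by measurable
  have "(\<integral>\<^sup>+x. g (x + h x *\<^sub>R b) \<partial>lborel) =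
      (\<integral>\<^sup>+f. (\<integral>\<^sup>+y. g (e f + (h (e f) + 1 * y) *\<^sub>R b) \<partial>lborel) \<partial>(\<Pi>\<^sub>M c\<in>Basis - {b}. lborel))"
    by (subst fubini) (simp_all add: h algebra_simps scaleR_add_left)
  also have "\<dots> = (\<integral>\<^sup>+f. (\<integral>\<^sup>+y. g (e f + y *\<^sub>R b) \<partial>lborel) \<partial>(\<Pi>\<^sub>M c\<in>Basis - {b}. lborel))"
  proof (rule nn_integral_cong)
    fix f :: "'a \<Rightarrow> real"
    show "(\<integral>\<^sup>+y. g (e f + (h (e f) + 1 * y) *\<^sub>R b) \<partial>lborel) = (\<integral>\<^sup>+y. g (e f + y *\<^sub>R b) \<partial>lborel)"
      using nn_integral_real_affine[of "\<lambda>y. g (e f + y *\<^sub>R b)" 1 "h (e f)"] by simp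
  qed
  also have "\<dots> = (\<integral>\<^sup>+x. g x \<partial>lborel)"
    by (subst fubini) simp_all
  finally show ?thesis .
qed

lemma measurable_matrix_vector_mult [measurable]:
  fixes A :: "real ^ 'n ^ 'm"
  shows "(*v) A \<in> borel \<rightarrow>\<^sub>M borel"
  by (intro borel_measurable_continuous_onI matrix_vector_mult_linear_continuous_on)

lemma Basis_cart: "(Basis :: (real ^ 'n) set) = range (\<lambda>i. axis i 1)"
  by (auto simp: Basis_vec_def)

lemma nn_integral_lborel_diagonal:
  fixes A :: "real ^ 'n ^ 'n"
  assumes diag: "\<And>i j. i \<noteq> j \<Longrightarrow> A $ i $ j = 0" and nz: "det A \<noteq> 0"
    and [measurable]: "g \<in> borel_measurable borel"
  shows "(\<integral>\<^sup>+x. g x \<partial>lborel) = ennreal \<bar>det A\<bar> * (\<integral>\<^sup>+x. g (A *v x) \<partial>lborel)"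
proof -
  have det: "det A = (\<Prod>i\<in>UNIV. A $ i $ i)" using diag by (rule det_diagonal)
  \<comment> \<open>\<open>lborel_affine_euclidean\<close> expects its scaling factors indexed by
    basis vectors; this linear functional takes the value \<open>A $ i $ i\<close> at
    \<open>axis i 1\<close>.\<close>
  define c where "c j = (\<Sum>i\<in>UNIV. A $ i $ i * j $ i)" for j :: "real ^ 'n"
  have c: "c (axis i 1) = A $ i $ i" for i
    by (simp add: c_def axis_def if_distrib cong: if_cong)
  have prod: "(\<Prod>j\<in>Basis. \<bar>c j\<bar>) = \<bar>det A\<bar>"
    by (simp add: Basis_cart det abs_prod prod.reindex inj_on_def axis_eq_axis c)
  have "c j \<noteq> 0" if "j \<in> Basis" for j
    using that nz c by (auto simp: Basis_cart det)
  then have "(lborel :: (real ^ 'n) measure) =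
      density (distr lborel borel (\<lambda>x. 0 + (\<Sum>j\<in>Basis. (c j * (x \<bullet> j)) *\<^sub>R j))) (\<lambda>_. (\<Prod>j\<in>Basis. \<bar>c j\<bar>))"
    by (rule lborel_affine_euclidean)
  also have "(\<lambda>x. 0 + (\<Sum>j\<in>Basis. (c j * (x \<bullet> j)) *\<^sub>R j)) = (\<lambda>x. A *v x)"
  proof
    fix x :: "real ^ 'n"
    have "(\<Sum>j\<in>Basis. (c j * (x \<bullet> j)) *\<^sub>R j) = (\<Sum>i\<in>UNIV. (A $ i $ i * x $ i) *\<^sub>R axis i 1)"
      by (simp add: Basis_cart sum.reindex inj_on_def axis_eq_axis c inner_axis)
    also have "\<dots> = A *v x"
    proof -
      have "(\<Sum>j\<in>UNIV. A $ i $ j * x $ j) = A $ i $ i * x $ i" for i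
        using diag by (subst sum.remove[of _ i]) (auto intro!: sum.neutral)
      then show ?thesis
        by (simp add: vec_eq_iff matrix_vector_mult_def axis_def if_distrib cong: if_cong)
    qed
    finally show "0 + (\<Sum>j\<in>Basis. (c j * (x \<bullet> j)) *\<^sub>R j) = A *v x" by simp
  qed
  finally have "(lborel :: (real ^ 'n) measure) =
      density (distr lborel borel (\<lambda>x. A *v x)) (\<lambda>_. ennreal \<bar>det A\<bar>)"
    by (simp only: prod)
  then have "(\<integral>\<^sup>+x. g x \<partial>lborel) =
      (\<integral>\<^sup>+x. g x \<partial>(density (distr lborel borel (\<lambda>x. A *v x)) (\<lambda>_. ennreal \<bar>det A\<bar>)))"
    by (rule arg_cong)
  also have "\<dots> = ennreal \<bar>det A\<bar> * (\<integral>\<^sup>+x. g (A *v x) \<partial>lborel)"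
    by (simp add: nn_integral_density nn_integral_distr nn_integral_cmult)
  finally show ?thesis .
qed

text \<open>Lebesgue measure is determined by its values on boxes, and the preimage of a box under a
  coordinate permutation is a box with the same side lengths in another order.\<close>

lemma nn_integral_lborel_permute:
  fixes g :: "real ^ 'n \<Rightarrow> ennreal"
  assumes p: "p permutes UNIV" and [measurable]: "g \<in> borel_measurable borel"
  shows "(\<integral>\<^sup>+x. g (\<chi> i. x $ p i) \<partial>lborel) = (\<integral>\<^sup>+x. g x \<partial>lborel)"
proof -
  have lin: "linear (\<lambda>x :: real ^ 'n. \<chi> i. x $ p i)"
    by (rule linearI) (simp_all add: vec_eq_iff)
  have [measurable]: "(\<lambda>x :: real ^ 'n. \<chi> i. x $ p i) \<in> borel \<rightarrow>\<^sub>M borel"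
    by (intro borel_measurable_continuous_onI linear_continuous_on linear_conv_bounded_linear[THEN iffD1] lin)
  have "(lborel :: (real ^ 'n) measure) = distr lborel borel (\<lambda>x. \<chi> i. x $ p i)"
  proof (rule lborel_eqI)
    fix l u :: "real ^ 'n" assume le: "\<And>b. b \<in> Basis \<Longrightarrow> l \<bullet> b \<le> u \<bullet> b"
    have le': "l $ i \<le> u $ i" for i
      using le[of "axis i 1"] by (simp add: inner_axis axis_in_Basis_iff)
    define q where "q = inv p"
    have q: "q permutes UNIV" "p (q i) = i" "q (p i) = i" for i
      using p by (simp_all add: q_def permutes_inv permutes_inverses)
    have eq: "(\<lambda>x. \<chi> i. x $ p i) -` box l u = box (\<chi> i. l $ q i) (\<chi> i. u $ q i)"
      by (auto simp: mem_box_cart) (metis q(2,3))+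
    have *: "(\<Prod>b\<in>Basis. v \<bullet> b) = (\<Prod>i\<in>UNIV. v $ i)" for v :: "real ^ 'n"
      by (simp add: Basis_cart prod.reindex inj_on_def axis_eq_axis inner_axis)
    have "emeasure (distr lborel borel (\<lambda>x. \<chi> i. x $ p i)) (box l u) =
        emeasure lborel (box (\<chi> i. l $ q i) (\<chi> i. u $ q i))"
      by (simp add: emeasure_distr eq)
    also have "\<dots> = (\<Prod>b\<in>Basis. ((\<chi> i. u $ q i) - (\<chi> i. l $ q i)) \<bullet> b)"
      by (rule emeasure_lborel_box) (auto simp: Basis_cart inner_axis le')
    also have "\<dots> = (\<Prod>b\<in>Basis. (u - l) \<bullet> b)"
      unfolding * using prod.permute[OF q(1), of "\<lambda>i. (u - l) $ i"] by (simp add: o_def)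
    finally show "emeasure (distr lborel borel (\<lambda>x. \<chi> i. x $ p i)) (box l u) = (\<Prod>b\<in>Basis. (u - l) \<bullet> b)" .
  qed simp
  then have "(\<integral>\<^sup>+x. g x \<partial>lborel) = (\<integral>\<^sup>+x. g x \<partial>distr lborel borel (\<lambda>x. \<chi> i. x $ p i))"
    by (rule arg_cong)
  also have "\<dots> = (\<integral>\<^sup>+x. g (\<chi> i. x $ p i) \<partial>lborel)"
    by (simp add: nn_integral_distr)
  finally show ?thesis by (rule sym)
qed

text \<open>The change-of-variables theorems of the library need a well-ordered index type.\<close>
lemma nn_integral_lborel_linear:
  fixes A :: "real ^ 'n ^ 'n"
  assumes "det A \<noteq> 0" and "g \<in> borel_measurable borel"
  shows "(\<integral>\<^sup>+x. g x \<partial>lborel) = ennreal \<bar>det A\<bar> * (\<integral>\<^sup>+x. g (A *v x) \<partial>lborel)"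
proof -
  \<comment> \<open>The determinant condition belongs to the induction formula so that a zero row
    makes its case vacuous. \<open>g\<close> is quantified because the product case uses the
    hypothesis for \<open>B\<close> at the function \<open>\<lambda>y. g (A *v y)\<close>.\<close>
  have "det A \<noteq> 0 \<longrightarrow> (\<forall>g\<in>borel_measurable borel.
      (\<integral>\<^sup>+x. g x \<partial>lborel) = ennreal \<bar>det A\<bar> * (\<integral>\<^sup>+x. g (A *v x) \<partial>lborel))"
  proof (induction A rule: induct_matrix_elementary_alt)
    case (1 A B)
    show ?case
    proof safe
      fix g :: "real ^ 'n \<Rightarrow> ennreal" assume g[measurable]: "g \<in> borel_measurable borel"
        and nz: "det (A ** B) \<noteq> 0"
      have "(\<integral>\<^sup>+x. g x \<partial>lborel) = ennreal \<bar>det A\<bar> * (\<integral>\<^sup>+x. g (A *v x) \<partial>lborel)"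
        by (rule 1(1)[rule_format]) (use nz in \<open>auto simp: det_mul\<close>)
      also have "(\<integral>\<^sup>+x. g (A *v x) \<partial>lborel) =
          ennreal \<bar>det B\<bar> * (\<integral>\<^sup>+x. g (A *v (B *v x)) \<partial>lborel)"
        by (rule 1(2)[rule_format]) (use nz in \<open>auto simp: det_mul\<close>)
      finally show "(\<integral>\<^sup>+x. g x \<partial>lborel) =
          ennreal \<bar>det (A ** B)\<bar> * (\<integral>\<^sup>+x. g ((A ** B) *v x) \<partial>lborel)"
        by (simp add: det_mul abs_mult ennreal_mult mult.assoc matrix_vector_mul_assoc)
    qed
  next
    case (2 A i)
    then show ?case by (simp add: det_zero_row)
  next
    case (3 A)
    then show ?case by (intro impI ballI nn_integral_lborel_diagonal)
  next
    case (4 m n)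
    define p where "p = Transposition.transpose m n"
    define A :: "real ^ 'n ^ 'n" where "A = (\<chi> i j. mat 1 $ i $ p j)"
    have p: "p permutes UNIV" "p (p i) = i" for i
      by (auto simp: p_def permutes_swap_id)
    have det: "\<bar>det A\<bar> = 1"
      using 4 by (simp add: A_def p_def det_permute_columns permutes_swap_id sign_swap_id)
    have A: "A *v x = (\<chi> i. x $ p i)" for x
    proof -
      have "mat 1 $ i $ p j * x $ j = (if j = p i then x $ j else 0)" for i j
        using p(2) by (auto simp: mat_def)
      then show ?thesis
        by (simp add: vec_eq_iff A_def matrix_vector_mult_def)
    qed
    have "(\<integral>\<^sup>+x. g x \<partial>lborel) = ennreal \<bar>det A\<bar> * (\<integral>\<^sup>+x. g (A *v x) \<partial>lborel)"
      if "g \<in> borel_measurable borel" for g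
      using nn_integral_lborel_permute[OF p(1) that] by (simp add: A det)
    then show ?case
      unfolding A_def p_def by blast
  next
    case (5 m n)
    define A :: "real ^ 'n ^ 'n" where "A = (\<chi> i j. of_bool (i = m \<and> j = n \<or> i = j))"
    have "A = (\<chi> k. if k = m then row m (mat 1) + 1 *s row n (mat 1) else row k (mat 1))"
      using 5 by (auto simp: A_def vec_eq_iff row_def mat_def)
    then have det: "det A = 1"
      using det_row_operation[OF 5, of "mat 1" 1] by simp
    \<comment> \<open>Since \<open>m\<close> differs from \<open>n\<close>, the coefficient
      \<open>x $ n\<close> is unchanged along \<open>axis m 1\<close>, which is the condition of the
      shear lemma.\<close>
    have A: "A *v x = x + (x $ n) *\<^sub>R axis m 1" for x
    proof -
      have "of_bool (i = m \<and> j = n \<or> i = j) * x $ j =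
          (if j = i then x $ j else 0) + (if j = n then if i = m then x $ j else 0 else 0)" for i j
        using 5 by auto
      then show ?thesis
        by (simp add: A_def vec_eq_iff matrix_vector_mult_def axis_def sum.distrib)
    qed
    have "(\<integral>\<^sup>+x. g (A *v x) \<partial>lborel) = (\<integral>\<^sup>+x. g x \<partial>lborel)"
      if "g \<in> borel_measurable borel" for g
    proof -
      have "(axis m 1 :: real ^ 'n) $ n = 0" using 5 by (simp add: axis_def)
      then show ?thesis
        unfolding A using that
        by (intro nn_integral_lborel_shear) (auto simp: axis_in_Basis_iff)
    qed
    then have "(\<integral>\<^sup>+x. g x \<partial>lborel) = ennreal \<bar>det A\<bar> * (\<integral>\<^sup>+x. g (A *v x) \<partial>lborel)"
      if "g \<in> borel_measurable borel" for g
      using that by (simp add: det)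
    then show ?case
      unfolding A_def by blast
  qed
  then show ?thesis using assms by blast
qed

section \<open>Positive definite matrices and Gaussian measures\<close>

lemma inner_matrix_left: "(A *v x) \<bullet> y = x \<bullet> (transpose A *v y)"
  for A :: "real ^ 'n ^ 'm"
  by (metis dot_lmul_matrix vector_transpose_matrix transpose_transpose)

lemma
  fixes A :: "real ^ 'n ^ 'n"
  assumes "invertible A"
  shows matrix_inv_right: "A ** matrix_inv A = mat 1"
    and matrix_inv_left: "matrix_inv A ** A = mat 1"
  using assms someI_ex[of "\<lambda>A'. A ** A' = mat 1 \<and> A' ** A = mat 1"]
  unfolding invertible_def matrix_inv_def by auto

lemma matrix_inv_unique:
  fixes A :: "real ^ 'n ^ 'n"
  assumes "A ** B = mat 1"
  shows "matrix_inv A = B"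
proof -
  have "invertible A"
    using assms invertible_right_inverse by blast
  then have "matrix_inv A ** (A ** B) = B"
    by (simp only: matrix_mul_assoc matrix_inv_left matrix_mul_lid)
  then show ?thesis using assms by simp
qed

lemma pos_def_invertible:
  assumes "pos_def S"
  shows "invertible S"
proof -
  have "x = 0" if "S *v x = 0" for x
    using assms that by (force simp: pos_def_def)
  then show ?thesis
    using matrix_left_invertible_ker[of S] invertible_left_inverse[of S] by blast
qed

lemma pos_def_matrix_inv:
  assumes "pos_def S"
  shows "pos_def (matrix_inv S)"
  unfolding pos_def_def
proof safe
  note inv = matrix_inv_left[OF pos_def_invertible[OF assms]] matrix_inv_right[OF pos_def_invertible[OF assms]]
  have sym: "transpose S = S" using assms by (simp add: pos_def_def)
  have "S ** transpose (matrix_inv S) = transpose (matrix_inv S ** S)"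
    by (simp add: matrix_transpose_mul sym)
  then have "S ** transpose (matrix_inv S) = mat 1"
    by (simp add: inv transpose_mat)
  then show "transpose (matrix_inv S) = matrix_inv S"
    by (rule matrix_inv_unique[symmetric])
  fix x :: "real ^ 'a" assume "x \<noteq> 0"
  have Sx: "S *v (matrix_inv S *v x) = x"
    by (simp add: matrix_vector_mul_assoc inv)
  with \<open>x \<noteq> 0\<close> have "matrix_inv S *v x \<noteq> 0" by (metis matrix_vector_mult_0_right)
  then have "0 < (matrix_inv S *v x) \<bullet> (S *v (matrix_inv S *v x))"
    using assms by (simp add: pos_def_def)
  then show "0 < x \<bullet> (matrix_inv S *v x)"
    by (simp add: Sx inner_commute)
qed

lemma pos_def_scaleR:
  assumes "c > 0" "pos_def S"
  shows "pos_def (c *\<^sub>R S)"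
proof -
  have "x \<bullet> ((c *\<^sub>R S) *v x) = c * (x \<bullet> (S *v x))" for x
    by (metis inner_scaleR_right scaleR_matrix_vector_assoc)
  then show ?thesis
    using assms by (auto simp: pos_def_def transpose_scalar)
qed

lemma pos_def_imp_sym: "pos_def S \<Longrightarrow> transpose S = S"
  by (simp add: pos_def_def)

lemma matrix_inv_matrix_inv: "invertible A \<Longrightarrow> matrix_inv (matrix_inv A) = A"
  for A :: "real ^ 'n ^ 'n"
  by (rule matrix_inv_unique) (rule matrix_inv_left)

lemma matrix_inv_scaleR:
  fixes A :: "real ^ 'n ^ 'n"
  assumes "c \<noteq> 0" "invertible A"
  shows "matrix_inv (c *\<^sub>R A) = (1 / c) *\<^sub>R matrix_inv A"
proof (rule matrix_inv_unique)
  have "(c *\<^sub>R A) ** ((1 / c) *\<^sub>R matrix_inv A) = (1 / c) *\<^sub>R (c *\<^sub>R (A ** matrix_inv A))"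
    by (metis matrix_scalar_ac scalar_matrix_assoc)
  then show "(c *\<^sub>R A) ** ((1 / c) *\<^sub>R matrix_inv A) = mat 1"
    using assms by (simp add: matrix_inv_right)
qed

text \<open>Gram--Schmidt for the inner product with Gram matrix \<open>S\<close>.\<close>
lemma pos_def_orthonormal_family:
  fixes S :: "real ^ 'n ^ 'n"
  assumes S: "pos_def S" and "finite I"
  shows "\<exists>v :: 'n \<Rightarrow> real ^ 'n. \<forall>i\<in>I. \<forall>j\<in>I. v i \<bullet> (S *v v j) = of_bool (i = j)"
  using \<open>finite I\<close>
proof (induction I rule: finite_induct)
  case empty
  then show ?case by simp
next
  case (insert k I)
  then obtain v where v: "\<And>i j. i \<in> I \<Longrightarrow> j \<in> I \<Longrightarrow> v i \<bullet> (S *v v j) = of_bool (i = j)"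
    by blast
  have sym: "x \<bullet> (S *v y) = y \<bullet> (S *v x)" for x y
    using pos_def_imp_sym[OF S] inner_matrix_left[of S x y] by (simp add: inner_commute)
  \<comment> \<open>Euclidean orthogonality to all \<open>S *v v i\<close> is orthogonality to all
    \<open>v i\<close> in the inner product of \<open>S\<close>. Counting dimensions yields a
    nonzero such vector as long as \<open>I\<close> misses an index; it only remains to normalise
    it.\<close>
  let ?W = "(\<lambda>i. S *v v i) ` I"
  have "card I < CARD('n)"
    using insert.hyps by (intro psubset_card_mono) auto
  then have "dim ?W < DIM(real ^ 'n)"
    using dim_le_card'[of ?W] card_image_le[of I "\<lambda>i. S *v v i"] insert.hyps by simp
  then obtain x where x: "x \<noteq> 0" "\<And>y. y \<in> span ?W \<Longrightarrow> orthogonal x y"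
    using orthogonal_to_subspace_exists[of ?W] by auto
  have xv: "x \<bullet> (S *v v i) = 0" if "i \<in> I" for i
    using x(2)[of "S *v v i"] that by (auto simp: orthogonal_def span_base)
  define s where "s = x \<bullet> (S *v x)"
  have s: "s > 0" using S x(1) by (simp add: s_def pos_def_def)
  define w where "w = (1 / sqrt s) *\<^sub>R x"
  have ww: "w \<bullet> (S *v w) = 1"
    using s by (simp add: w_def matrix_vector_mult_scaleR s_def[symmetric])
  have wv: "w \<bullet> (S *v v i) = 0" "v i \<bullet> (S *v w) = 0" if "i \<in> I" for i
    using xv[OF that] sym[of "v i" w] by (simp_all add: w_def)
  have "\<forall>i\<in>insert k I. \<forall>j\<in>insert k I. (v(k := w)) i \<bullet> (S *v (v(k := w)) j) = of_bool (i = j)"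
    using v ww wv insert.hyps by auto
  then show ?case by blast
qed

text \<open>The columns of \<open>P\<close> are an orthonormal basis for the inner product of
  \<open>S\<close>. In what follows \<open>P\<close> plays the part of an inverse square root of
  \<open>S\<close>: it gives the sign of the determinant and the substitution that standardises a
  Gaussian.\<close>

lemma pos_def_congruent_mat_1:
  fixes S :: "real ^ 'n ^ 'n"
  assumes "pos_def S"
  obtains P :: "real ^ 'n ^ 'n" where "transpose P ** S ** P = mat 1"
proof -
  obtain v :: "'n \<Rightarrow> real ^ 'n" where v: "\<And>i j. v i \<bullet> (S *v v j) = of_bool (i = j)"
    using pos_def_orthonormal_family[OF assms finite_class.finite_UNIV] by blast
  define P where "P = (\<chi> i j. v j $ i)"
  have "(transpose P ** (S ** P)) $ i $ j = v i \<bullet> (S *v v j)" for i j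
    by (simp add: P_def matrix_matrix_mult_def transpose_def inner_vec_def matrix_vector_mult_def)
  then have "transpose P ** S ** P = mat 1"
    by (simp add: vec_eq_iff mat_def v matrix_mul_assoc)
  then show ?thesis by (rule that)
qed

lemma pos_def_det_pos:
  fixes S :: "real ^ 'n ^ 'n"
  assumes "pos_def S"
  shows "det S > 0"
proof -
  obtain P :: "real ^ 'n ^ 'n" where "transpose P ** S ** P = mat 1"
    using pos_def_congruent_mat_1[OF assms] .
  then have "det (transpose P ** S ** P) = 1" by simp
  then have "(det P)\<^sup>2 * det S = 1"
    by (simp add: det_mul power2_eq_square mult_ac)
  then show ?thesis
    using mult_nonneg_nonpos[of "(det P)\<^sup>2" "det S"] by (cases "det S > 0") auto
qed

section \<open>Normalisation of Gaussian densities and measurability of Gaussian kernels\<close>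

lemma nn_integral_std_gaussian:
  "(\<integral>\<^sup>+x. ennreal (exp (- (1/2) * ((x :: real ^ 'n) \<bullet> x))) \<partial>lborel) = ennreal (sqrt ((2 * pi) ^ CARD('n)))"
proof -
  have one: "(\<integral>\<^sup>+y. ennreal (exp (- (1/2) * y\<^sup>2)) \<partial>lborel) = ennreal (sqrt (2 * pi))"
  proof -
    have "(\<integral>\<^sup>+y. ennreal (exp (- (1/2) * y\<^sup>2)) \<partial>lborel) =
        (\<integral>\<^sup>+y. ennreal (sqrt (2 * pi)) * ennreal (std_normal_density y) \<partial>lborel)"
      by (intro nn_integral_cong) (simp add: std_normal_density_def ennreal_mult[symmetric])
    also have "\<dots> = ennreal (sqrt (2 * pi)) * (\<integral>\<^sup>+y. ennreal (std_normal_density y) \<partial>lborel)"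
      by (rule nn_integral_cmult) simp
    also have "(\<integral>\<^sup>+y. ennreal (std_normal_density y) \<partial>lborel) = 1"
      using prob_space.emeasure_space_1[OF prob_space_normal_density[of 1 0]]
      by (simp add: emeasure_density)
    finally show ?thesis by simp
  qed
  \<comment> \<open>The exponential of a sum of squares factorises over the coordinates, which
    leaves one copy of the one-dimensional integral for each basis vector.\<close>
  have "ennreal (exp (- (1/2) * (x \<bullet> x))) = (\<Prod>b\<in>Basis. ennreal (exp (- (1/2) * (x \<bullet> b)\<^sup>2)))"
    for x :: "real ^ 'n"
    by (subst euclidean_inner)
      (simp add: prod_ennreal exp_sum[symmetric] sum_distrib_left power2_eq_square)
  then have "(\<integral>\<^sup>+x. ennreal (exp (- (1/2) * ((x :: real ^ 'n) \<bullet> x))) \<partial>lborel) =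
      (\<integral>\<^sup>+x. (\<Prod>b\<in>(Basis :: (real ^ 'n) set). ennreal (exp (- (1/2) * (x \<bullet> b)\<^sup>2))) \<partial>lborel)"
    by simp
  also have "\<dots> = (\<Prod>b\<in>(Basis :: (real ^ 'n) set). ennreal (sqrt (2 * pi)))"
    by (subst nn_integral_lborel_prod) (simp_all only: one zero_le, measurable)
  also have "\<dots> = ennreal (sqrt ((2 * pi) ^ CARD('n)))"
    by (simp add: ennreal_power real_sqrt_power[symmetric])
  finally show ?thesis .
qed

definition gaussian_density :: "real ^ 'k \<Rightarrow> real ^ 'k ^ 'k \<Rightarrow> real ^ 'k \<Rightarrow> real" where
  "gaussian_density \<mu> S u =
     exp (- (1/2) * ((u - \<mu>) \<bullet> (matrix_inv S *v (u - \<mu>)))) / sqrt ((2 * pi) ^ CARD('k) * det S)"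

lemma gaussian_eq: "gaussian \<mu> S = density lborel (\<lambda>u. ennreal (gaussian_density \<mu> S u))"
  by (simp add: gaussian_def gaussian_density_def)

lemma gaussian_density_nonneg: "pos_def S \<Longrightarrow> 0 \<le> gaussian_density \<mu> S u"
  using pos_def_det_pos[of S] by (simp add: gaussian_density_def)

lemma measurable_gaussian_density [measurable (raw)]:
  assumes [measurable]: "f \<in> borel_measurable M" "g \<in> borel_measurable M"
  shows "(\<lambda>x. gaussian_density (f x) S (g x)) \<in> borel_measurable M"
proof -
  have [measurable]: "(\<lambda>x. matrix_inv S *v (g x - f x)) \<in> borel_measurable M"
    by (rule measurable_compose[OF _ measurable_matrix_vector_mult]) simp
  show ?thesis unfolding gaussian_density_def by measurable
qed

lemma sets_gaussian [simp]: "sets (gaussian \<mu> S) = sets borel"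
  by (simp add: gaussian_eq)

text \<open>The substitution u = \<mu> + P w, with \<open>P\<close> orthonormalising the inverse
  covariance, turns the exponent into that of the standard Gaussian. Its Jacobian
  \<open>\<bar>det P\<bar>\<close> equals \<open>sqrt (det S)\<close> and cancels the determinant in
  the normalising factor.\<close>

lemma prob_space_gaussian:
  fixes S :: "real ^ 'n ^ 'n"
  assumes S: "pos_def S"
  shows "prob_space (gaussian \<mu> S)"
proof
  define R where "R = matrix_inv S"
  have R: "pos_def R" unfolding R_def using S by (rule pos_def_matrix_inv)
  obtain P :: "real ^ 'n ^ 'n" where P: "transpose P ** R ** P = mat 1"
    using pos_def_congruent_mat_1[OF R] .
  have quad: "(P *v x) \<bullet> (R *v (P *v x)) = x \<bullet> x" for x
  proof -
    have "(P *v x) \<bullet> (R *v (P *v x)) = x \<bullet> ((transpose P ** R ** P) *v x)"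
      by (simp add: inner_matrix_left matrix_vector_mul_assoc matrix_mul_assoc)
    then show ?thesis by (simp add: P)
  qed
  have "S ** R = mat 1"
    unfolding R_def using S by (intro matrix_inv_right pos_def_invertible)
  then have "det S * det R = 1" by (metis det_mul det_I)
  moreover have "(det P)\<^sup>2 * det R = 1"
    using arg_cong[OF P, of det] by (simp add: det_mul power2_eq_square mult_ac)
  ultimately have detP: "(det P)\<^sup>2 = det S" and nz: "det P \<noteq> 0"
    by (metis mult_cancel_right mult_zero_right zero_neq_one, auto)
  then have absP: "\<bar>det P\<bar> = sqrt (det S)" by (metis real_sqrt_abs)
  define c where "c = sqrt ((2 * pi) ^ CARD('n) * det S)"
  have c: "c > 0" using pos_def_det_pos[OF S] by (simp add: c_def)
  have "emeasure (gaussian \<mu> S) (space (gaussian \<mu> S)) = (\<integral>\<^sup>+u. ennreal (gaussian_density \<mu> S u) \<partial>lborel)"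
    by (simp add: gaussian_eq emeasure_density)
  also have "\<dots> = (\<integral>\<^sup>+u. ennreal (gaussian_density \<mu> S (\<mu> + u)) \<partial>lborel)"
    by (subst lborel_distr_plus[of \<mu>, symmetric]) (simp add: nn_integral_distr)
  also have "\<dots> = (\<integral>\<^sup>+u. ennreal (1 / c) * ennreal (exp (- (1/2) * (u \<bullet> (R *v u)))) \<partial>lborel)"
    using c by (intro nn_integral_cong) (simp add: gaussian_density_def R_def c_def ennreal_mult[symmetric])
  also have "\<dots> = ennreal (1 / c) * (\<integral>\<^sup>+u. ennreal (exp (- (1/2) * (u \<bullet> (R *v u)))) \<partial>lborel)"
    by (intro nn_integral_cmult) measurable
  also have "(\<integral>\<^sup>+u. ennreal (exp (- (1/2) * (u \<bullet> (R *v u)))) \<partial>lborel) =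
      ennreal \<bar>det P\<bar> * (\<integral>\<^sup>+u. ennreal (exp (- (1/2) * ((P *v u) \<bullet> (R *v (P *v u))))) \<partial>lborel)"
    by (intro nn_integral_lborel_linear nz) measurable
  also have "\<dots> = ennreal \<bar>det P\<bar> * ennreal (sqrt ((2 * pi) ^ CARD('n)))"
    by (simp only: quad nn_integral_std_gaussian)
  also have "ennreal \<bar>det P\<bar> * ennreal (sqrt ((2 * pi) ^ CARD('n))) = ennreal c"
    using pos_def_det_pos[OF S]
    by (simp add: absP c_def ennreal_mult[symmetric] real_sqrt_mult mult_ac)
  also have "ennreal (1 / c) * ennreal c = 1"
    using c by (simp add: ennreal_mult[symmetric])
  finally show "emeasure (gaussian \<mu> S) (space (gaussian \<mu> S)) = 1" .
qed

text \<open>Makes policies of Gaussian kernels: the reference has constant mean, the optimal policy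
  a mean linear in the state, and both have covariances that do not depend on the state.\<close>

lemma measurable_gaussian:
  fixes S :: "real ^ 'n ^ 'n"
  assumes S: "pos_def S" and [measurable]: "f \<in> borel_measurable M"
  shows "(\<lambda>x. gaussian (f x) S) \<in> M \<rightarrow>\<^sub>M prob_algebra borel"
proof (intro measurable_prob_algebraI measurable_subprob_algebra)
  show "prob_space (gaussian (f x) S)" for x using S by (rule prob_space_gaussian)
  then show "subprob_space (gaussian (f x) S)" for x by (rule prob_space_imp_subprob_space)
  show "sets (gaussian (f x) S) = sets borel" for x by simp
  fix A :: "(real ^ 'n) set" assume [measurable]: "A \<in> sets borel"
  have "emeasure (gaussian (f x) S) A = (\<integral>\<^sup>+u. ennreal (gaussian_density (f x) S u) * indicator A u \<partial>lborel)" for x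
    unfolding gaussian_eq by (rule emeasure_density) auto
  then show "(\<lambda>x. emeasure (gaussian (f x) S) A) \<in> borel_measurable M"
    by simp
qed

section \<open>The Gibbs variational principle\<close>

lemma ext_expectation_nonneg:
  assumes "\<And>x. 0 \<le> g x"
  shows "ext_expectation P g = enn2ereal (\<integral>\<^sup>+x. ennreal (g x) \<partial>P)"
  using assms by (simp add: ext_expectation_def ennreal_neg zero_ennreal.rep_eq)

lemma ext_expectation_eq_integral:
  assumes "\<And>x. 0 \<le> g x" "integrable P g"
  shows "ext_expectation P g = ereal (\<integral>x. g x \<partial>P)"
  using assms by (simp add: ext_expectation_nonneg nn_integral_eq_integral enn2ereal_ennreal)

text \<open>By uniqueness of the Radon-Nikodym derivative the entropy density is
  \<open>ln (f x)\<close>, but only almost everywhere, so integrability and value are transferred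
  along that equality. The integrability hypothesis selects the finite branch of
  \<open>KL_div\<close>.\<close>

lemma KL_div_density:
  assumes "prob_space M" and f[measurable]: "f \<in> borel_measurable M" and pos: "\<And>x. 0 < f x"
    and int: "integrable (density M (\<lambda>x. ennreal (f x))) (\<lambda>x. ln (f x))"
  shows "KL_div (density M (\<lambda>x. ennreal (f x))) M = ereal (\<integral>x. ln (f x) \<partial>density M (\<lambda>x. ennreal (f x)))"
proof -
  interpret prob_space M by fact
  let ?P = "density M (\<lambda>x. ennreal (f x))"
  have ac: "absolutely_continuous M ?P"
    by (rule absolutely_continuousI_density) measurable
  have "AE x in M. ennreal (f x) = RN_deriv M ?P x"
    by (rule RN_deriv_unique) simp_all
  then have "AE x in M. ln (f x) = entropy_density (exp 1) M ?P x"
    by eventually_elim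
      (metis entropy_density_def comp_apply enn2real_ennreal less_imp_le pos log_ln)
  then have AE: "AE x in ?P. ln (f x) = entropy_density (exp 1) M ?P x"
    by (subst AE_density) auto
  have [measurable]: "entropy_density (exp 1) M ?P \<in> borel_measurable ?P"
    unfolding entropy_density_def comp_def by simp
  have "integrable ?P (entropy_density (exp 1) M ?P)"
    using AE int by (subst integrable_cong_AE[symmetric, where f = "\<lambda>x. ln (f x)"]) auto
  moreover have "KL_divergence (exp 1) M ?P = (\<integral>x. ln (f x) \<partial>?P)"
    unfolding KL_divergence_def using AE by (intro integral_cong_AE) auto
  ultimately show ?thesis using ac by (simp add: KL_div_def)
qed

text \<open>The logarithm of the Gibbs density is \<open>(c - \<Phi> x) / lam\<close>, so \<lambda>
  times the divergence is \<open>c\<close> minus the expected cost, and the cost cancels.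
  Normalisation forces c to be the free energy, -\<lambda> times the logarithm of the integral of
  exp(-\<Phi>/\<lambda>).\<close>

lemma free_energy_gibbs:
  assumes lam: "lam > 0" and M: "prob_space M" and \<Phi>[measurable]: "\<Phi> \<in> borel_measurable M"
    and nonneg: "\<And>x. 0 \<le> \<Phi> x"
    and prob: "prob_space (density M (\<lambda>x. ennreal (exp ((c - \<Phi> x) / lam))))" (is "prob_space ?G")
  shows "ext_expectation ?G \<Phi> + ereal lam * KL_div ?G M = ereal c"
proof -
  interpret M: prob_space M by fact
  interpret G: prob_space ?G by fact
  \<comment> \<open>From y exp(-y) \<le> 1 at y = \<Phi>/\<lambda>: the Gibbs weight damps the cost
    to a bounded function, hence \<Phi> is integrable under the Gibbs law however fast it
    grows.\<close>
  have bound: "exp ((c - \<Phi> x) / lam) * \<Phi> x \<le> exp (c / lam) * lam" for x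
  proof -
    have "\<Phi> x / lam \<le> exp (\<Phi> x / lam)" using exp_ge_add_one_self[of "\<Phi> x / lam"] by linarith
    then have "exp (- (\<Phi> x / lam)) * (\<Phi> x / lam) \<le> 1"
      using lam by (simp add: exp_minus divide_le_eq inverse_eq_divide)
    then have "exp (c / lam) * lam * (exp (- (\<Phi> x / lam)) * (\<Phi> x / lam)) \<le> exp (c / lam) * lam * 1"
      using lam by (intro mult_left_mono) auto
    moreover have "exp ((c - \<Phi> x) / lam) = exp (c / lam) * exp (- (\<Phi> x / lam))"
      by (simp add: exp_add[symmetric] diff_divide_distrib)
    ultimately show ?thesis using lam by (simp add: mult_ac)
  qed
  have "integrable M (\<lambda>x. exp ((c - \<Phi> x) / lam) * \<Phi> x)"
    by (rule M.integrable_const_bound[where B = "exp (c / lam) * lam"])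
      (auto intro!: AE_I2 simp: nonneg bound abs_mult)
  then have int: "integrable ?G \<Phi>"
    by (subst integrable_real_density) auto
  then have "KL_div ?G M = ereal (\<integral>x. (c - \<Phi> x) / lam \<partial>?G)"
    using M by (subst KL_div_density) auto
  also have "(\<integral>x. (c - \<Phi> x) / lam \<partial>?G) = (c - (\<integral>x. \<Phi> x \<partial>?G)) / lam"
    using int G.prob_space by simp
  finally show ?thesis
    using lam int nonneg by (simp add: ext_expectation_eq_integral)
qed

text \<open>With \<open>g\<close> the Gibbs density and \<open>h\<close> the density of the
  competitor, both relative to \<open>M\<close>, the bound is ln r \<le> r - 1 at r = g/h,
  integrated under \<open>P\<close>. The integral of g/h is at most the mass of the Gibbs law, which
  is one.\<close>

lemma free_energy_ge:
  assumes lam: "lam > 0" and M: "prob_space M" and \<Phi>[measurable]: "\<Phi> \<in> borel_measurable M"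
    and nonneg: "\<And>x. 0 \<le> \<Phi> x"
    and prob: "prob_space (density M (\<lambda>x. ennreal (exp ((c - \<Phi> x) / lam))))" (is "prob_space ?G")
    and P: "prob_space P" "sets P = sets M"
  shows "ereal c \<le> ext_expectation P \<Phi> + ereal lam * KL_div P M"
proof -
  interpret M: prob_space M by fact
  interpret P: prob_space P by fact
  have E: "ext_expectation P \<Phi> = enn2ereal (\<integral>\<^sup>+x. ennreal (\<Phi> x) \<partial>P)"
    by (rule ext_expectation_nonneg) (rule nonneg)
  have [measurable]: "\<Phi> \<in> borel_measurable P"
    using \<Phi> P(2) measurable_cong_sets by blast
  \<comment> \<open>The expected cost is nonnegative and the divergence is real or \<infinity>, so
    in the first two cases the sum is \<infinity>. Only in the third do real integrals have to be
    compared.\<close>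
  consider (inf) "KL_div P M = \<infinity>" | (E_inf) "(\<integral>\<^sup>+x. ennreal (\<Phi> x) \<partial>P) = \<infinity>" "KL_div P M \<noteq> \<infinity>"
    | (fin) "KL_div P M \<noteq> \<infinity>" "(\<integral>\<^sup>+x. ennreal (\<Phi> x) \<partial>P) \<noteq> \<infinity>" by blast
  then show ?thesis
  proof cases
    case inf
    then show ?thesis using lam E by simp
  next
    case E_inf
    then obtain k where "KL_div P M = ereal k"
      by (auto simp: KL_div_def split: if_splits)
    then show ?thesis using E_inf E by simp
  next
    case fin
    then have ac: "absolutely_continuous M P"
      and int: "integrable P (entropy_density (exp 1) M P)"
      and KL: "KL_div P M = ereal (\<integral>x. entropy_density (exp 1) M P x \<partial>P)"
      by (auto simp: KL_div_def KL_divergence_def split: if_splits)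
    have int\<Phi>: "integrable P \<Phi>"
      using fin by (intro integrableI_nonneg) (auto simp: nonneg top.not_eq_extremum)
    \<comment> \<open>\<open>enn2real\<close> replaces the value \<infinity> by 0, which happens
      only on an \<open>M\<close>-null set, so \<open>h\<close> is still a density of
      \<open>P\<close>.\<close>
    define h where "h x = enn2real (RN_deriv M P x)" for x
    have [measurable]: "h \<in> borel_measurable M" unfolding h_def by measurable
    have fin_RN: "AE x in M. RN_deriv M P x \<noteq> \<infinity>"
      using M.RN_deriv_finite[OF P.sigma_finite_measure_axioms ac P(2)] .
    have PM: "P = density M (\<lambda>x. ennreal (h x))"
    proof -
      have "P = density M (RN_deriv M P)"
        using M.density_RN_deriv[OF ac P(2)] by simp
      also have "\<dots> = density M (\<lambda>x. ennreal (h x))"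
        using fin_RN by (intro density_cong) (auto simp: h_def top.not_eq_extremum)
      finally show ?thesis .
    qed
    have ent: "entropy_density (exp 1) M P x = ln (h x)" for x
      by (simp add: entropy_density_def h_def log_ln)
    have hpos: "AE x in P. 0 < h x"
      by (subst PM, subst AE_density) (auto simp: h_def)
    define g where "g x = exp ((c - \<Phi> x) / lam)" for x
    have [measurable]: "g \<in> borel_measurable M" unfolding g_def by measurable
    have [measurable]: "h \<in> borel_measurable P" "g \<in> borel_measurable P"
      using P(2) by (auto cong: measurable_cong_sets)
    have gpos: "0 < g x" for x by (simp add: g_def)
    have gh: "0 \<le> g x / h x" "0 \<le> h x" for x
      using gpos[of x] by (simp_all add: h_def less_imp_le)
    have "(\<integral>\<^sup>+x. ennreal (g x / h x) \<partial>P) = (\<integral>\<^sup>+x. ennreal (h x) * ennreal (g x / h x) \<partial>M)"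
      by (subst PM, subst nn_integral_density) auto
    \<comment> \<open>Where \<open>h\<close> vanishes, \<open>g x / h x\<close> is 0 by the
      convention for division, while \<open>g x\<close> is positive; hence an inequality rather than
      an equality.\<close>
    also have "\<dots> \<le> (\<integral>\<^sup>+x. ennreal (g x) \<partial>M)"
      using gh gpos by (intro nn_integral_mono) (auto simp: ennreal_mult[symmetric] less_imp_le)
    also have "\<dots> = 1"
      using prob_space.emeasure_space_1[OF prob] by (simp add: emeasure_density g_def)
    finally have le1: "(\<integral>\<^sup>+x. ennreal (g x / h x) \<partial>P) \<le> 1" .
    then have intgh: "integrable P (\<lambda>x. g x / h x)"
      using gh by (intro integrableI_nonneg) (auto intro: le_less_trans)
    have "ennreal (\<integral>x. g x / h x \<partial>P) \<le> 1"
      using le1 gh(1) by (subst nn_integral_eq_integral[symmetric, OF intgh]) auto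
    then have "(\<integral>x. g x / h x \<partial>P) - 1 \<le> 0" by (simp add: ennreal_le_1)
    moreover have "(\<integral>x. (c - \<Phi> x) / lam - ln (h x) \<partial>P) \<le> (\<integral>x. g x / h x - 1 \<partial>P)"
    proof (rule integral_mono_AE)
      show "integrable P (\<lambda>x. (c - \<Phi> x) / lam - ln (h x))"
        using int int\<Phi> by (simp add: ent[abs_def])
      show "integrable P (\<lambda>x. g x / h x - 1)" using intgh by simp
      show "AE x in P. (c - \<Phi> x) / lam - ln (h x) \<le> g x / h x - 1"
        using hpos
      proof eventually_elim
        case (elim x)
        then show ?case
          using ln_le_minus_one[of "g x / h x"] gpos[of x] by (simp add: ln_div g_def)
      qed
    qed
    ultimately have "(c - (\<integral>x. \<Phi> x \<partial>P)) / lam - (\<integral>x. ln (h x) \<partial>P) \<le> 0"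
      using int int\<Phi> intgh by (simp add: ent[abs_def] P.prob_space)
    then have "c \<le> (\<integral>x. \<Phi> x \<partial>P) + lam * (\<integral>x. ln (h x) \<partial>P)"
      using lam by (simp add: field_simps)
    then show ?thesis
      using KL ext_expectation_eq_integral[OF nonneg int\<Phi>] by (simp add: ent)
  qed
qed

section \<open>Densities of trajectory laws\<close>

lemma measurable_traj_step:
  assumes [measurable]: "(\<lambda>(x, u). f x u) \<in> borel \<Otimes>\<^sub>M borel \<rightarrow>\<^sub>M borel"
  shows "(\<lambda>(w, v). ((fst w)(Suc t := f (fst w t) v), (snd w)(t := v)))
    \<in> (traj_space t :: ((nat \<Rightarrow> real ^ 'n) \<times> (nat \<Rightarrow> real ^ 'm)) measure) \<Otimes>\<^sub>M borel \<rightarrow>\<^sub>M traj_space (Suc t)"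
proof -
  let ?N = "(traj_space t :: ((nat \<Rightarrow> real ^ 'n) \<times> (nat \<Rightarrow> real ^ 'm)) measure) \<Otimes>\<^sub>M borel"
  have x[measurable]: "(\<lambda>z. fst (fst z)) \<in> ?N \<rightarrow>\<^sub>M (\<Pi>\<^sub>M s\<in>{..t}. borel)"
    and u[measurable]: "(\<lambda>z. snd (fst z)) \<in> ?N \<rightarrow>\<^sub>M (\<Pi>\<^sub>M s\<in>{..<t}. borel)"
    unfolding traj_space_def by measurable
  have [measurable]: "(\<lambda>z. fst (fst z) t) \<in> borel_measurable ?N"
    by (rule measurable_compose[OF x measurable_component_singleton]) simp
  have "(\<lambda>z. (fst (fst z))(Suc t := f (fst (fst z) t) (snd z))) \<in> ?N \<rightarrow>\<^sub>M (\<Pi>\<^sub>M s\<in>{..Suc t}. borel)"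
    by (rule measurable_fun_upd[OF _ x]) (auto simp: atMost_Suc)
  moreover have "(\<lambda>z. (snd (fst z))(t := snd z)) \<in> ?N \<rightarrow>\<^sub>M (\<Pi>\<^sub>M s\<in>{..<Suc t}. borel)"
    by (rule measurable_fun_upd[OF _ u]) (auto simp: lessThan_Suc)
  ultimately show ?thesis
    unfolding traj_space_def[of "Suc t"] case_prod_beta by (rule measurable_Pair)
qed

lemma measurable_traj_state [measurable (raw)]:
  assumes "s \<le> t"
  shows "(\<lambda>w. fst w s) \<in> borel_measurable (traj_space t)"
  unfolding traj_space_def using assms
  by (intro measurable_compose[OF measurable_fst measurable_component_singleton]) simp

lemma measurable_traj_control [measurable (raw)]:
  assumes "s < t"
  shows "(\<lambda>w. snd w s) \<in> borel_measurable (traj_space t)"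
  unfolding traj_space_def using assms
  by (intro measurable_compose[OF measurable_snd measurable_component_singleton]) simp

lemma measurable_traj_kernel:
  fixes f :: "nat \<Rightarrow> real ^ 'n \<Rightarrow> real ^ 'm \<Rightarrow> real ^ 'n"
  assumes f: "(\<lambda>(x, u). f t x u) \<in> borel \<Otimes>\<^sub>M borel \<rightarrow>\<^sub>M borel"
    and Q: "Q t \<in> borel \<rightarrow>\<^sub>M prob_algebra borel"
  shows "(\<lambda>(x, u). distr (Q t (x t)) (traj_space (Suc t)) (\<lambda>v. (x(Suc t := f t (x t) v), u(t := v))))
    \<in> traj_space t \<rightarrow>\<^sub>M prob_algebra (traj_space (Suc t))"
proof -
  have "(\<lambda>w. Q t (fst w t)) \<in> traj_space t \<rightarrow>\<^sub>M prob_algebra borel"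
    by (rule measurable_compose[OF measurable_traj_state Q]) simp
  from measurable_distr_prob_space2[OF this measurable_traj_step[OF f]]
  show ?thesis by (simp add: case_prod_beta)
qed

lemma initial_traj_in_space:
  "(\<lambda>t\<in>{..0}. x0, \<lambda>t\<in>{..<0}. undefined) \<in> space (traj_space 0)"
  by (simp add: traj_space_def space_pair_measure space_PiM)

lemma traj_law_prob_algebra:
  fixes f :: "nat \<Rightarrow> real ^ 'n \<Rightarrow> real ^ 'm \<Rightarrow> real ^ 'n"
  assumes f: "\<And>s. s < T \<Longrightarrow> (\<lambda>(x, u). f s x u) \<in> borel \<Otimes>\<^sub>M borel \<rightarrow>\<^sub>M borel"
    and Q: "\<And>s. s < T \<Longrightarrow> Q s \<in> borel \<rightarrow>\<^sub>M prob_algebra borel"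
    and "t \<le> T"
  shows "traj_law f x0 Q t \<in> space (prob_algebra (traj_space t))"
  using \<open>t \<le> T\<close>
proof (induction t)
  case 0
  show ?case
    using prob_space_return[OF initial_traj_in_space] by (simp add: space_prob_algebra)
next
  case (Suc t)
  \<comment> \<open>A single law is regarded as a constant kernel, so that closure of probability
    kernels under \<open>bind\<close> applies to it.\<close>
  then have "(\<lambda>_. traj_law f x0 Q t) \<in> count_space UNIV \<rightarrow>\<^sub>M prob_algebra (traj_space t)" by simp
  moreover have "(\<lambda>(x, u). distr (Q t (x t)) (traj_space (Suc t)) (\<lambda>v. (x(Suc t := f t (x t) v), u(t := v))))
      \<in> traj_space t \<rightarrow>\<^sub>M prob_algebra (traj_space (Suc t))"
    using f[of t] Q[of t] Suc.prems by (intro measurable_traj_kernel) simp_all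
  ultimately have "(\<lambda>_. traj_law f x0 Q (Suc t)) \<in> count_space UNIV \<rightarrow>\<^sub>M prob_algebra (traj_space (Suc t))"
    unfolding traj_law.simps by (rule measurable_bind_prob_space)
  from measurable_space[OF this] show ?case by simp
qed

text \<open>The recursion in integral form: it replaces \<open>bind\<close> and \<open>distr\<close>
  by an iterated integral, so that trajectory laws can be compared by integrating
  indicators.\<close>

lemma nn_integral_traj_law_Suc:
  fixes f :: "nat \<Rightarrow> real ^ 'n \<Rightarrow> real ^ 'm \<Rightarrow> real ^ 'n"
  assumes f: "\<And>s. s < T \<Longrightarrow> (\<lambda>(x, u). f s x u) \<in> borel \<Otimes>\<^sub>M borel \<rightarrow>\<^sub>M borel"
    and Q: "\<And>s. s < T \<Longrightarrow> Q s \<in> borel \<rightarrow>\<^sub>M prob_algebra borel"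
    and t: "t < T" and k[measurable]: "k \<in> borel_measurable (traj_space (Suc t))"
  shows "(\<integral>\<^sup>+w. k w \<partial>traj_law f x0 Q (Suc t)) =
    (\<integral>\<^sup>+w. (\<integral>\<^sup>+v. k ((fst w)(Suc t := f t (fst w t) v), (snd w)(t := v)) \<partial>Q t (fst w t)) \<partial>traj_law f x0 Q t)"
proof -
  have sets: "sets (traj_law f x0 Q t) = sets (traj_space t)"
    using traj_law_prob_algebra[OF f Q less_imp_le[OF t]] by (simp add: space_prob_algebra)
  have "(\<lambda>(x, u). distr (Q t (x t)) (traj_space (Suc t)) (\<lambda>v. (x(Suc t := f t (x t) v), u(t := v))))
      \<in> traj_law f x0 Q t \<rightarrow>\<^sub>M subprob_algebra (traj_space (Suc t))"
    using measurable_prob_algebraD[OF measurable_traj_kernel[of f t Q, OF f[OF t] Q[OF t]]]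
    by (simp add: measurable_cong_sets[OF sets refl])
  then have "(\<integral>\<^sup>+w. k w \<partial>traj_law f x0 Q (Suc t)) =
      (\<integral>\<^sup>+w. (\<integral>\<^sup>+y. k y \<partial>distr (Q t (fst w t)) (traj_space (Suc t))
        (\<lambda>v. ((fst w)(Suc t := f t (fst w t) v), (snd w)(t := v)))) \<partial>traj_law f x0 Q t)"
    by (simp add: nn_integral_bind[OF k] case_prod_beta)
  also have "\<dots> = (\<integral>\<^sup>+w. (\<integral>\<^sup>+v. k ((fst w)(Suc t := f t (fst w t) v), (snd w)(t := v)) \<partial>Q t (fst w t))
      \<partial>traj_law f x0 Q t)"
  proof (intro nn_integral_cong nn_integral_distr)
    fix w assume "w \<in> space (traj_law f x0 Q t)"
    then have w: "w \<in> space (traj_space t)" using sets sets_eq_imp_space_eq by blast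
    have setsQt: "sets (Q t (fst w t)) = sets borel"
      using measurable_space[OF Q[OF t], of "fst w t"] by (simp add: space_prob_algebra)
    show "(\<lambda>v. ((fst w)(Suc t := f t (fst w t) v), (snd w)(t := v))) \<in> Q t (fst w t) \<rightarrow>\<^sub>M traj_space (Suc t)"
      using measurable_Pair2[OF measurable_traj_step[OF f[OF t]] w]
      by (simp add: measurable_cong_sets[OF setsQt refl])
  qed simp
  finally show ?thesis .
qed

text \<open>The exponents telescope along the recursion, leaving the accumulated cost plus the
  value \<open>V\<close> of the current state.\<close>
lemma traj_law_density:
  fixes f :: "nat \<Rightarrow> real ^ 'n \<Rightarrow> real ^ 'm \<Rightarrow> real ^ 'n"
  assumes f: "\<And>s. s < T \<Longrightarrow> (\<lambda>(x, u). f s x u) \<in> borel \<Otimes>\<^sub>M borel \<rightarrow>\<^sub>M borel"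
    and R: "\<And>s. s < T \<Longrightarrow> R s \<in> borel \<rightarrow>\<^sub>M prob_algebra borel"
    and Q: "\<And>s. s < T \<Longrightarrow> Q s \<in> borel \<rightarrow>\<^sub>M prob_algebra borel"
    and C: "\<And>s. s < T \<Longrightarrow> (\<lambda>(x, u). C s x u) \<in> borel_measurable (borel \<Otimes>\<^sub>M borel)"
    and V: "\<And>s. s \<le> T \<Longrightarrow> V s \<in> borel_measurable borel"
    and dens: "\<And>s x. s < T \<Longrightarrow> Q s x =
      density (R s x) (\<lambda>u. ennreal (exp ((V s x - C s x u - V (Suc s) (f s x u)) / lam)))"
    and "t \<le> T"
  shows "traj_law f x0 Q t = density (traj_law f x0 R t)
    (\<lambda>w. ennreal (exp ((V 0 x0 - ((\<Sum>s<t. C s (fst w s) (snd w s)) + V t (fst w t))) / lam)))"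
  using \<open>t \<le> T\<close>
proof (induction t)
  case 0
  have [measurable]: "V 0 \<in> borel_measurable borel" using V by simp
  show ?case
  proof (rule measure_eqI)
    fix X assume "X \<in> sets (traj_law f x0 Q 0)"
    then have X[measurable]: "X \<in> sets (traj_space 0)" by simp
    let ?w = "(\<lambda>t\<in>{..0 :: nat}. x0, \<lambda>t\<in>{..<0 :: nat}. undefined :: real ^ 'm)"
    show "emeasure (traj_law f x0 Q 0) X = emeasure (density (traj_law f x0 R 0)
        (\<lambda>w. ennreal (exp ((V 0 x0 - ((\<Sum>s<0. C s (fst w s) (snd w s)) + V 0 (fst w 0))) / lam)))) X"
    proof -
      have [measurable]: "(\<lambda>w. V 0 (fst w 0)) \<in> borel_measurable (traj_space 0)"
        by (rule measurable_compose[OF measurable_traj_state]) simp_all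
      have w: "?w \<in> space (traj_space 0)" by (rule initial_traj_in_space)
      have "emeasure (density (traj_law f x0 R 0) (\<lambda>w. ennreal (exp ((V 0 x0 - V 0 (fst w 0)) / lam)))) X =
          (\<integral>\<^sup>+w. ennreal (exp ((V 0 x0 - V 0 (fst w 0)) / lam)) * indicator X w \<partial>return (traj_space 0) ?w)"
        unfolding traj_law.simps by (rule emeasure_density) simp_all
      \<comment> \<open>Both initial laws are the same point mass, and the weight at that point is
        exp 0 = 1 because its state at time 0 is \<open>x0\<close>.\<close>
      also have "\<dots> = indicator X ?w"
        by (subst nn_integral_return[OF w]) simp_all
      also have "\<dots> = emeasure (traj_law f x0 Q 0) X"
        unfolding traj_law.simps by (rule emeasure_return[symmetric]) simp
      finally show ?thesis by simp
    qed
  qed simp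
next
  case (Suc t)
  note traj_law.simps [simp del]
  define G where "G t w = ennreal (exp ((V 0 x0 - ((\<Sum>s<t. C s (fst w s) (snd w s)) + V t (fst w t))) / lam))"
    for t and w :: "(nat \<Rightarrow> real ^ 'n) \<times> (nat \<Rightarrow> real ^ 'm)"
  define nxt where "nxt w v = ((fst w)(Suc t := f t (fst w t) v), (snd w)(t := v))"
    for w :: "(nat \<Rightarrow> real ^ 'n) \<times> (nat \<Rightarrow> real ^ 'm)" and v
  have t: "t < T" using Suc.prems by simp
  have IH: "traj_law f x0 Q t = density (traj_law f x0 R t) (G t)"
    using Suc by (simp add: G_def[abs_def])
  have G[measurable]: "G s \<in> borel_measurable (traj_space s)" if "s \<le> T" for s
  proof -
    have [measurable]: "V s \<in> borel_measurable borel" using V that by simp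
    have C': "(\<lambda>w. C r (fst w r) (snd w r)) \<in> borel_measurable (traj_space s)" if "r < s" for r
      using measurable_compose[OF measurable_Pair[OF measurable_traj_state measurable_traj_control] C, of r s r]
        that \<open>s \<le> T\<close> by simp
    have [measurable]: "(\<lambda>w. \<Sum>r<s. C r (fst w r) (snd w r)) \<in> borel_measurable (traj_space s)"
      by (rule borel_measurable_sum) (use C' in auto)
    have [measurable]: "(\<lambda>w. V s (fst w s)) \<in> borel_measurable (traj_space s)"
      by (rule measurable_compose[OF measurable_traj_state]) simp_all
    show ?thesis unfolding G_def by measurable
  qed
  have setsR: "sets (traj_law f x0 R s) = sets (traj_space s)"
    and setsQ: "sets (traj_law f x0 Q s) = sets (traj_space s)" if "s \<le> T" for s
    using traj_law_prob_algebra[OF f R that] traj_law_prob_algebra[OF f Q that]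
    by (simp_all add: space_prob_algebra)
  show ?case unfolding G_def[symmetric]
  proof (rule measure_eqI)
    show "sets (traj_law f x0 Q (Suc t)) = sets (density (traj_law f x0 R (Suc t)) (G (Suc t)))"
      by (simp only: setsR[OF Suc.prems] setsQ[OF Suc.prems] sets_density)
    fix X assume "X \<in> sets (traj_law f x0 Q (Suc t))"
    then have X[measurable]: "X \<in> sets (traj_space (Suc t))"
      by (simp only: setsQ[OF Suc.prems])
    have [measurable]: "case_prod (f t) \<in> borel \<Otimes>\<^sub>M borel \<rightarrow>\<^sub>M borel"
      "case_prod (C t) \<in> borel_measurable (borel \<Otimes>\<^sub>M borel)"
      "V t \<in> borel_measurable borel" "V (Suc t) \<in> borel_measurable borel"
      using f[OF t] C[OF t] V[of t] V[of "Suc t"] t by simp_all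
    have nxt[measurable]: "(\<lambda>z. nxt (fst z) (snd z)) \<in> traj_space t \<Otimes>\<^sub>M borel \<rightarrow>\<^sub>M traj_space (Suc t)"
      using measurable_traj_step[OF f[OF t]] by (simp add: nxt_def case_prod_beta)
    have meas: "(\<lambda>w. \<integral>\<^sup>+v. indicator X (nxt w v) \<partial>Q t (fst w t)) \<in> borel_measurable (traj_space t)"
    proof (rule nn_integral_measurable_subprob_algebra2)
      show "(\<lambda>(w, v). indicator X (nxt w v) :: ennreal) \<in> borel_measurable (traj_space t \<Otimes>\<^sub>M borel)"
        unfolding case_prod_beta by measurable
      show "(\<lambda>w. Q t (fst w t)) \<in> traj_space t \<rightarrow>\<^sub>M subprob_algebra borel"
        by (rule measurable_compose[OF measurable_traj_state measurable_prob_algebraD[OF Q[OF t]]]) simp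
    qed
    have "emeasure (traj_law f x0 Q (Suc t)) X = (\<integral>\<^sup>+w. indicator X w \<partial>traj_law f x0 Q (Suc t))"
      using X setsQ[OF Suc.prems] by (intro nn_integral_indicator[symmetric]) simp
    also have "\<dots> = (\<integral>\<^sup>+w. (\<integral>\<^sup>+v. indicator X (nxt w v) \<partial>Q t (fst w t)) \<partial>traj_law f x0 Q t)"
      unfolding nxt_def by (rule nn_integral_traj_law_Suc[OF f Q t]) simp_all
    also have "\<dots> = (\<integral>\<^sup>+w. G t w * (\<integral>\<^sup>+v. indicator X (nxt w v) \<partial>Q t (fst w t)) \<partial>traj_law f x0 R t)"
      unfolding IH using G[OF less_imp_le[OF t]] meas
      by (intro nn_integral_density) (simp_all only: measurable_cong_sets[OF setsR[OF less_imp_le[OF t]] refl])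
    \<comment> \<open>Changing the control kernel from \<open>Q t\<close> to \<open>R t\<close>
      brings in the one-step weight \<open>D v\<close>, which multiplies the weight
      \<open>G t w\<close> of the past to give the weight of the extended trajectory.\<close>
    also have "\<dots> = (\<integral>\<^sup>+w. (\<integral>\<^sup>+v. G (Suc t) (nxt w v) * indicator X (nxt w v) \<partial>R t (fst w t)) \<partial>traj_law f x0 R t)"
    proof (rule nn_integral_cong)
      fix w assume "w \<in> space (traj_law f x0 R t)"
      then have w: "w \<in> space (traj_space t)"
        using sets_eq_imp_space_eq[OF setsR[OF less_imp_le[OF t]]] by simp
      have setsRt: "sets (R t (fst w t)) = sets borel"
        using measurable_space[OF R[OF t], of "fst w t"] by (simp add: space_prob_algebra)
      define D where "D v = ennreal (exp ((V t (fst w t) - C t (fst w t) v - V (Suc t) (f t (fst w t) v)) / lam))" for v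
      have [measurable]: "D \<in> borel_measurable borel" unfolding D_def by measurable
      have [measurable]: "nxt w \<in> borel \<rightarrow>\<^sub>M traj_space (Suc t)"
        using measurable_Pair2[OF nxt w] by simp
      have I: "(\<lambda>v. indicator X (nxt w v) :: ennreal) \<in> borel_measurable borel" by measurable
      have "(\<integral>\<^sup>+v. indicator X (nxt w v) \<partial>Q t (fst w t)) = (\<integral>\<^sup>+v. D v * indicator X (nxt w v) \<partial>R t (fst w t))"
        unfolding dens[OF t] D_def[symmetric] using I
        by (intro nn_integral_density) (simp_all only: measurable_cong_sets[OF setsRt refl], measurable)
      then have "G t w * (\<integral>\<^sup>+v. indicator X (nxt w v) \<partial>Q t (fst w t)) =
          (\<integral>\<^sup>+v. G t w * (D v * indicator X (nxt w v)) \<partial>R t (fst w t))"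
        by (simp only:) (rule nn_integral_cmult[symmetric],
          simp only: measurable_cong_sets[OF setsRt refl], measurable)
      also have "\<dots> = (\<integral>\<^sup>+v. G (Suc t) (nxt w v) * indicator X (nxt w v) \<partial>R t (fst w t))"
      proof (rule nn_integral_cong)
        fix v
        let ?S = "\<Sum>s<t. C s (fst w s) (snd w s)"
        \<comment> \<open>\<open>nxt\<close> changes only the state at \<open>Suc t\<close> and the
          control at \<open>t\<close>, so earlier costs and the state at \<open>t\<close> are those
          of \<open>w\<close>.\<close>
        have "(\<Sum>s<Suc t. C s (fst (nxt w v) s) (snd (nxt w v) s)) = ?S + C t (fst w t) v"
          by (simp add: nxt_def)
        then have "G (Suc t) (nxt w v) = ennreal (exp ((V 0 x0 -
            (?S + C t (fst w t) v + V (Suc t) (f t (fst w t) v))) / lam))"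
          by (simp add: G_def nxt_def)
        also have "(V 0 x0 - (?S + C t (fst w t) v + V (Suc t) (f t (fst w t) v))) / lam =
            (V 0 x0 - (?S + V t (fst w t))) / lam +
            (V t (fst w t) - C t (fst w t) v - V (Suc t) (f t (fst w t) v)) / lam"
          by (simp add: diff_divide_distrib add_divide_distrib)
        finally have "G (Suc t) (nxt w v) = G t w * D v"
          by (simp only: G_def D_def exp_add ennreal_mult exp_ge_zero)
        then show "G t w * (D v * indicator X (nxt w v)) = G (Suc t) (nxt w v) * indicator X (nxt w v)"
          by (simp only: mult.assoc)
      qed
      finally show "G t w * (\<integral>\<^sup>+v. indicator X (nxt w v) \<partial>Q t (fst w t)) =
          (\<integral>\<^sup>+v. G (Suc t) (nxt w v) * indicator X (nxt w v) \<partial>R t (fst w t))" .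
    qed
    also have "\<dots> = (\<integral>\<^sup>+w. G (Suc t) w * indicator X w \<partial>traj_law f x0 R (Suc t))"
      unfolding nxt_def using G[OF Suc.prems]
      by (intro nn_integral_traj_law_Suc[OF f R t, symmetric]) simp_all
    also have "\<dots> = emeasure (density (traj_law f x0 R (Suc t)) (G (Suc t))) X"
      using G[OF Suc.prems] X setsR[OF Suc.prems]
      by (intro emeasure_density[symmetric]) (simp_all only: measurable_cong_sets[OF setsR[OF Suc.prems] refl])
    finally show "emeasure (traj_law f x0 Q (Suc t)) X = emeasure (density (traj_law f x0 R (Suc t)) (G (Suc t))) X" .
  qed
qed

section \<open>The Riccati recursion\<close>

definition pos_semidef :: "real ^ 'k ^ 'k \<Rightarrow> bool" where
  "pos_semidef S \<longleftrightarrow> transpose S = S \<and> (\<forall>x. 0 \<le> x \<bullet> (S *v x))"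

lemma pos_def_imp_pos_semidef: "pos_def S \<Longrightarrow> pos_semidef S"
  unfolding pos_def_def pos_semidef_def
  by (metis inner_zero_left less_eq_real_def)

lemma symmetric_inner_swap:
  fixes S :: "real ^ 'k ^ 'k"
  assumes "transpose S = S"
  shows "x \<bullet> (S *v y) = y \<bullet> (S *v x)"
  using inner_matrix_left[of S x y] inner_commute[of y "S *v x"] by (simp only: assms)

lemma transpose_matrix_add: "transpose (A + B) = transpose A + transpose B"
  and transpose_matrix_diff: "transpose (A - B) = transpose A - transpose B"
  for A B :: "real ^ 'n ^ 'm"
  by (simp_all add: transpose_def vec_eq_iff)

text \<open>A single backward step: \<open>\<Theta>\<close> belongs to the later time and
  \<open>\<Theta>'\<close> to the earlier one. \<open>W\<close> is a quadratic control weight; it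
  will be \<open>lam *\<^sub>R matrix_inv \<Omega>\<close>, the form that \<lambda> times the
  negative logarithm of the reference density contributes.\<close>

locale riccati_step =
  fixes A \<Theta> M \<Theta>' :: "real ^ 'n ^ 'n" and B G :: "real ^ 'm ^ 'n" and W H :: "real ^ 'm ^ 'm"
  assumes \<Theta>: "pos_semidef \<Theta>" and W: "pos_def W" and M: "pos_semidef M"
    and G_eq: "G = transpose A ** \<Theta> ** B"
    and H_eq: "H = transpose B ** \<Theta> ** B + W"
    and \<Theta>'_eq: "\<Theta>' = transpose A ** \<Theta> ** A + M
        - transpose A ** \<Theta> ** B ** matrix_inv H ** transpose B ** \<Theta> ** A"
begin

lemma sym_\<Theta>: "transpose \<Theta> = \<Theta>"
  using \<Theta> by (simp add: pos_semidef_def)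

lemma inner_congruence: "x \<bullet> ((transpose P ** S ** P) *v x) = (P *v x) \<bullet> (S *v (P *v x))"
  for P :: "real ^ 'k ^ 'l"
  by (simp add: inner_matrix_left matrix_vector_mul_assoc matrix_mul_assoc del: transpose_matrix_vector)

lemma pos_def_H: "pos_def H"
  unfolding pos_def_def
proof safe
  show "transpose H = H"
    using pos_def_imp_sym[OF W]
    by (simp add: H_eq transpose_matrix_add matrix_transpose_mul sym_\<Theta> matrix_mul_assoc)
  fix u :: "real ^ 'm" assume "u \<noteq> 0"
  then have "0 < u \<bullet> (W *v u)" using W by (simp add: pos_def_def)
  moreover have "0 \<le> (B *v u) \<bullet> (\<Theta> *v (B *v u))" using \<Theta> by (simp add: pos_semidef_def)
  ultimately show "0 < u \<bullet> (H *v u)"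
    by (simp add: H_eq matrix_vector_mult_add_rdistrib inner_add_right inner_congruence)
qed

definition gain :: "real ^ 'n \<Rightarrow> real ^ 'm" where
  "gain x = (matrix_inv H ** transpose G) *v x"

text \<open>Both sides are quadratic in \<open>u\<close> with the same matrix \<open>H\<close>. The
  linear terms agree because \<open>gain x\<close> solves
  \<open>H *v gain x = transpose G *v x\<close>, and the constant left over is the term subtracted
  in the Riccati equation. Twice the Bellman equation, it yields both the mean
  \<open>- gain x\<close> and the next quadratic form.\<close>

lemma completion_of_squares:
  "(u + gain x) \<bullet> (H *v (u + gain x)) + x \<bullet> (\<Theta>' *v x) =
   x \<bullet> (M *v x) + (A *v x + B *v u) \<bullet> (\<Theta> *v (A *v x + B *v u)) + u \<bullet> (W *v u)"
proof -
  define a c where "a = A *v x" and "c = B *v u"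
  define b where "b = transpose B *v (\<Theta> *v a)"
  have transG: "transpose G *v x = b"
    by (simp add: G_eq matrix_transpose_mul sym_\<Theta> b_def a_def matrix_vector_mul_assoc matrix_mul_assoc
        del: transpose_matrix_vector)
  then have gain: "gain x = matrix_inv H *v b"
    by (simp add: gain_def matrix_vector_mul_assoc[symmetric] del: transpose_matrix_vector)
  have Hgain: "H *v gain x = b"
    using matrix_inv_right[OF pos_def_invertible[OF pos_def_H]]
    by (simp add: gain matrix_vector_mul_assoc)
  have ub: "v \<bullet> b = (B *v v) \<bullet> (\<Theta> *v a)" for v
    by (simp only: b_def inner_matrix_left)
  have "gain x \<bullet> (H *v u) = u \<bullet> b"
    by (subst symmetric_inner_swap[OF pos_def_imp_sym[OF pos_def_H]]) (simp only: Hgain)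
  then have lhs: "(u + gain x) \<bullet> (H *v (u + gain x)) = u \<bullet> (H *v u) + 2 * (u \<bullet> b) + gain x \<bullet> b"
    by (simp add: matrix_vector_right_distrib inner_add_left inner_add_right Hgain)
  have uHu: "u \<bullet> (H *v u) = c \<bullet> (\<Theta> *v c) + u \<bullet> (W *v u)"
    by (simp add: H_eq matrix_vector_mult_add_rdistrib inner_add_right inner_congruence c_def)
  \<comment> \<open>The subtracted Riccati term, evaluated at \<open>x\<close>, is the constant
    \<open>gain x \<bullet> b\<close> produced by expanding the square.\<close>
  have "x \<bullet> ((transpose A ** \<Theta> ** B ** matrix_inv H ** transpose B ** \<Theta> ** A) *v x) =
      x \<bullet> (transpose A *v (\<Theta> *v (B *v gain x)))"
    by (simp add: gain b_def a_def matrix_vector_mul_assoc matrix_mul_assoc del: transpose_matrix_vector)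
  also have "\<dots> = a \<bullet> (\<Theta> *v (B *v gain x))"
    by (simp only: a_def inner_matrix_left)
  also have "\<dots> = gain x \<bullet> b"
    by (subst symmetric_inner_swap[OF sym_\<Theta>]) (simp only: ub)
  finally have x\<Theta>'x: "x \<bullet> (\<Theta>' *v x) = a \<bullet> (\<Theta> *v a) + x \<bullet> (M *v x) - gain x \<bullet> b"
    by (simp add: \<Theta>'_eq matrix_vector_mult_add_rdistrib matrix_vector_mult_diff_rdistrib
        inner_add_right inner_diff_right inner_congruence a_def)
  have "a \<bullet> (\<Theta> *v c) = c \<bullet> (\<Theta> *v a)"
    by (rule symmetric_inner_swap[OF sym_\<Theta>])
  then have "(a + c) \<bullet> (\<Theta> *v (a + c)) = a \<bullet> (\<Theta> *v a) + 2 * (u \<bullet> b) + c \<bullet> (\<Theta> *v c)"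
    by (simp add: matrix_vector_right_distrib inner_add_left inner_add_right ub c_def)
  then show ?thesis
    unfolding lhs uHu x\<Theta>'x a_def[symmetric] c_def[symmetric] by simp
qed

text \<open>At the minimising control \<open>- gain x\<close> the square vanishes, which writes the
  quadratic form of \<open>\<Theta>'\<close> as a sum of nonnegative terms despite the minus sign in
  its definition.\<close>

lemma pos_semidef_riccati: "pos_semidef \<Theta>'"
  unfolding pos_semidef_def
proof safe
  have "transpose M = M" "transpose (matrix_inv H) = matrix_inv H"
    using M pos_def_imp_sym[OF pos_def_matrix_inv[OF pos_def_H]] by (simp_all add: pos_semidef_def)
  then show "transpose \<Theta>' = \<Theta>'"
    by (simp add: \<Theta>'_eq transpose_matrix_add transpose_matrix_diff matrix_transpose_mul sym_\<Theta> matrix_mul_assoc)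
  fix x
  have nonneg: "0 \<le> y \<bullet> (S *v y)" if "pos_semidef S" for S :: "real ^ 'k ^ 'k" and y
    using that by (simp add: pos_semidef_def)
  define u where "u = - gain x"
  have "u + gain x = 0" by (simp add: u_def)
  then have "x \<bullet> (\<Theta>' *v x) =
      x \<bullet> (M *v x) + (A *v x + B *v u) \<bullet> (\<Theta> *v (A *v x + B *v u)) + u \<bullet> (W *v u)"
    using completion_of_squares[of u x] by simp
  also have "\<dots> \<ge> 0"
    using \<Theta> M pos_def_imp_pos_semidef[OF W] by (intro add_nonneg_nonneg nonneg)
  finally show "0 \<le> x \<bullet> (\<Theta>' *v x)" .
qed

end

text \<open>The normalising constants of the two Gaussians do not depend on the state; they shift the
  value function by a constant.\<close>
lemma gaussian_riccati_step:
  fixes \<Omega> :: "real ^ 'm ^ 'm"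
  assumes lam: "lam > 0" and \<Omega>: "pos_def \<Omega>"
    and step: "riccati_step A \<Theta> M \<Theta>' B G (lam *\<^sub>R matrix_inv \<Omega>) H"
  defines "\<kappa> \<equiv> lam * ln (sqrt ((2 * pi) ^ CARD('m) * det \<Omega>) / sqrt ((2 * pi) ^ CARD('m) * det (lam *\<^sub>R matrix_inv H)))"
  shows "gaussian (- ((matrix_inv H ** transpose G) *v x)) (lam *\<^sub>R matrix_inv H) =
    density (gaussian 0 \<Omega>) (\<lambda>u. ennreal (exp ((1/2 * (x \<bullet> (\<Theta>' *v x)) + \<kappa> - 1/2 * (x \<bullet> (M *v x))
      - 1/2 * ((A *v x + B *v u) \<bullet> (\<Theta> *v (A *v x + B *v u)))) / lam)))"
proof -
  interpret riccati_step A \<Theta> M \<Theta>' B G "lam *\<^sub>R matrix_inv \<Omega>" H by fact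
  define e where "e u = exp ((1/2 * (x \<bullet> (\<Theta>' *v x)) + \<kappa> - 1/2 * (x \<bullet> (M *v x))
      - 1/2 * ((A *v x + B *v u) \<bullet> (\<Theta> *v (A *v x + B *v u)))) / lam)" for u
  define d1 d2 where "d1 = sqrt ((2 * pi) ^ CARD('m) * det \<Omega>)"
    and "d2 = sqrt ((2 * pi) ^ CARD('m) * det (lam *\<^sub>R matrix_inv H))"
  have d: "d1 > 0" "d2 > 0"
    using pos_def_det_pos[OF \<Omega>] pos_def_det_pos[OF pos_def_scaleR[OF lam pos_def_matrix_inv[OF pos_def_H]]]
    by (simp_all add: d1_def d2_def)
  have invH: "invertible H" using pos_def_H by (rule pos_def_invertible)
  have inv: "matrix_inv (lam *\<^sub>R matrix_inv H) = (1 / lam) *\<^sub>R H"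
    using lam matrix_inv_scaleR[of lam "matrix_inv H"] pos_def_invertible[OF pos_def_matrix_inv[OF pos_def_H]]
    by (simp add: matrix_inv_matrix_inv[OF invH])
  have eq: "gaussian_density (- gain x) (lam *\<^sub>R matrix_inv H) u = gaussian_density 0 \<Omega> u * e u" for u
  proof -
    define q where "q = (u + gain x) \<bullet> (H *v (u + gain x))"
    define r where "r = u \<bullet> (matrix_inv \<Omega> *v u)"
    define k where "k = 1/2 * (x \<bullet> (\<Theta>' *v x)) - 1/2 * (x \<bullet> (M *v x))
      - 1/2 * ((A *v x + B *v u) \<bullet> (\<Theta> *v (A *v x + B *v u)))"
    have "u \<bullet> ((lam *\<^sub>R matrix_inv \<Omega>) *v u) = lam * r"
      unfolding r_def by (metis inner_scaleR_right scaleR_matrix_vector_assoc)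
    \<comment> \<open>After multiplication by -1/(2\<lambda>) this splits the Gaussian exponent of
      the policy into that of the reference and the Bellman exponent \<open>k / lam\<close>.\<close>
    then have q: "q = lam * r - 2 * k"
      using completion_of_squares[of u x] by (simp add: q_def k_def field_simps)
    have "(u + gain x) \<bullet> (((1 / lam) *\<^sub>R H) *v (u + gain x)) = q / lam"
      unfolding q_def scaleR_matrix_vector_assoc[symmetric] by simp
    then have "gaussian_density (- gain x) (lam *\<^sub>R matrix_inv H) u = exp (- (1/2) * (q / lam)) / d2"
      by (simp add: gaussian_density_def inv d2_def)
    also have "- (1/2) * (q / lam) = - (1/2) * r + k / lam"
      using lam by (simp add: q field_simps)
    also have "exp (- (1/2) * r + k / lam) / d2 = exp (- (1/2) * r) / d1 * (exp (k / lam) * (d1 / d2))"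
    proof -
      have "p * q / d2 = p / d1 * (q * (d1 / d2))" for p q
        using d by simp
      then show ?thesis unfolding exp_add .
    qed
    \<comment> \<open>The choice of \<open>\<kappa>\<close> is dictated here: it absorbs the
      quotient of the two normalising factors into the exponent.\<close>
    also have "d1 / d2 = exp (\<kappa> / lam)"
      unfolding \<kappa>_def d1_def[symmetric] d2_def[symmetric] using d lam by simp
    also have "exp (k / lam) * exp (\<kappa> / lam) = e u"
      by (simp add: e_def k_def exp_add[symmetric] add_divide_distrib[symmetric] algebra_simps)
    also have "exp (- (1/2) * r) / d1 = gaussian_density 0 \<Omega> u"
      by (simp add: gaussian_density_def r_def d1_def)
    finally show ?thesis .
  qed
  have [measurable]: "e \<in> borel_measurable borel"
    unfolding e_def by measurable
  have "gaussian (- gain x) (lam *\<^sub>R matrix_inv H) =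
      density lborel (\<lambda>u. ennreal (gaussian_density 0 \<Omega> u) * ennreal (e u))"
    by (simp add: gaussian_eq eq ennreal_mult' gaussian_density_nonneg[OF \<Omega>])
  also have "\<dots> = density (gaussian 0 \<Omega>) (\<lambda>u. ennreal (e u))"
    unfolding gaussian_eq by (rule density_density_eq[symmetric]) measurable
  finally show ?thesis by (simp only: gain_def e_def)
qed

section \<open>Optimality of the Gaussian feedback policy\<close>

theorem theorem19:
  fixes T :: nat and lam :: real and x0 :: "real ^ 'n"
    and A M \<Omega> \<Theta> :: "nat \<Rightarrow> real ^ 'n ^ 'n"
    and B G :: "nat \<Rightarrow> real ^ 'm ^ 'n"
    and N \<Omega>hat H :: "nat \<Rightarrow> real ^ 'm ^ 'm"
  assumes lam_pos: "lam > 0"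
    and M_pos: "\<And>t. t \<le> T \<Longrightarrow> pos_def (M t)"
    and N_pos: "\<And>t. t < T \<Longrightarrow> pos_def (N t)"
    and Omega_hat_pos: "\<And>t. t < T \<Longrightarrow> pos_def (\<Omega>hat t)"
    and N_eq: "\<And>t. t < T \<Longrightarrow> N t = lam *\<^sub>R matrix_inv (\<Omega>hat t)"
    and Omega_eq: "\<And>t. t < T \<Longrightarrow> B t ** \<Omega>hat t ** transpose (B t) = \<Omega> t"
    and Theta_T: "\<Theta> T = M T"
    and Theta_rec: "\<And>t. t < T \<Longrightarrow>
      \<Theta> t = transpose (A t) ** \<Theta> (t + 1) ** A t + M t
        - transpose (A t) ** \<Theta> (t + 1) ** B t
          ** matrix_inv (transpose (B t) ** \<Theta> (t + 1) ** B t + lam *\<^sub>R matrix_inv (\<Omega>hat t))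
          ** transpose (B t) ** \<Theta> (t + 1) ** A t"
    and G_eq: "\<And>t. t < T \<Longrightarrow> G t = transpose (A t) ** \<Theta> (t + 1) ** B t"
    and H_eq: "\<And>t. t < T \<Longrightarrow>
      H t = transpose (B t) ** \<Theta> (t + 1) ** B t + lam *\<^sub>R matrix_inv (\<Omega>hat t)"
  shows "KL_control_optimal lam
    (\<lambda>t x u. A t *v x + B t *v u)
    (\<lambda>t x u. 1/2 * (x \<bullet> (M t *v x)))
    (\<lambda>x. 1/2 * (x \<bullet> (M T *v x)))
    (\<lambda>t x. gaussian 0 (\<Omega>hat t))
    x0 T
    (\<lambda>t x. gaussian (- ((matrix_inv (H t) ** transpose (G t)) *v x)) (lam *\<^sub>R matrix_inv (H t)))"
proof -
  \<comment> \<open>Semidefiniteness of \<open>\<Theta> (Suc t)\<close> enters the locale while that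
    of \<open>\<Theta> t\<close> comes out of it. The step is therefore conditional first, then
    feeds a backward induction from \<open>T\<close>, and only afterwards holds
    unconditionally.\<close>
  have stepI: "riccati_step (A t) (\<Theta> (Suc t)) (M t) (\<Theta> t) (B t) (G t) (lam *\<^sub>R matrix_inv (\<Omega>hat t)) (H t)"
    if "t < T" "pos_semidef (\<Theta> (Suc t))" for t
  proof
    show "pos_def (lam *\<^sub>R matrix_inv (\<Omega>hat t))"
      using lam_pos Omega_hat_pos[OF that(1)] by (intro pos_def_scaleR pos_def_matrix_inv)
    show "pos_semidef (M t)"
      using M_pos that(1) by (intro pos_def_imp_pos_semidef) simp
    show "\<Theta> t = transpose (A t) ** \<Theta> (Suc t) ** A t + M t
        - transpose (A t) ** \<Theta> (Suc t) ** B t ** matrix_inv (H t) ** transpose (B t) ** \<Theta> (Suc t) ** A t"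
      using Theta_rec[OF that(1)] H_eq[OF that(1)] by simp
  qed (use that G_eq H_eq in simp_all)
  have psd: "pos_semidef (\<Theta> t)" if "t \<le> T" for t
    using that
  proof (induction t rule: inc_induct)
    case base
    then show ?case using Theta_T M_pos by (simp add: pos_def_imp_pos_semidef)
  next
    case (step t)
    then show ?case using riccati_step.pos_semidef_riccati[OF stepI] by simp
  qed
  have step: "riccati_step (A t) (\<Theta> (Suc t)) (M t) (\<Theta> t) (B t) (G t) (lam *\<^sub>R matrix_inv (\<Omega>hat t)) (H t)"
    if "t < T" for t
    using that psd[of "Suc t"] by (intro stepI) simp_all

  let ?f = "\<lambda>t x u. A t *v x + B t *v u"
  let ?C = "\<lambda>t (x :: real ^ 'n) (u :: real ^ 'm). 1/2 * (x \<bullet> (M t *v x))"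
  let ?R = "\<lambda>t (x :: real ^ 'n). gaussian 0 (\<Omega>hat t)"
  let ?Q = "\<lambda>t x. gaussian (- ((matrix_inv (H t) ** transpose (G t)) *v x)) (lam *\<^sub>R matrix_inv (H t))"
  let ?\<Phi> = "\<lambda>(x, u :: nat \<Rightarrow> real ^ 'm). (\<Sum>t<T. ?C t (x t) (u t)) + 1/2 * (x T \<bullet> (M T *v x T))"
  define \<kappa> where "\<kappa> t = lam * ln (sqrt ((2 * pi) ^ CARD('m) * det (\<Omega>hat t)) /
      sqrt ((2 * pi) ^ CARD('m) * det (lam *\<^sub>R matrix_inv (H t))))" for t
  \<comment> \<open>The sum collects the normalising corrections still to come. It is empty at
    \<open>T\<close>, so \<open>V T\<close> is the terminal cost, and passing from \<open>t\<close>
    to \<open>Suc t\<close> removes exactly \<open>\<kappa> t\<close>.\<close>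
  define V where "V t x = 1/2 * (x \<bullet> (\<Theta> t *v x)) + (\<Sum>s\<in>{t..<T}. \<kappa> s)" for t x

  have f: "(\<lambda>(x, u). ?f t x u) \<in> borel \<Otimes>\<^sub>M borel \<rightarrow>\<^sub>M borel" for t
    unfolding case_prod_beta by measurable
  have C: "(\<lambda>(x, u). ?C t x u) \<in> borel_measurable (borel \<Otimes>\<^sub>M borel)" for t
    unfolding case_prod_beta by measurable
  have V: "V t \<in> borel_measurable borel" for t
    unfolding V_def by measurable
  have R: "?R t \<in> borel \<rightarrow>\<^sub>M prob_algebra borel" if "t < T" for t
    using Omega_hat_pos[OF that] by (intro measurable_gaussian) simp_all
  have Q: "?Q t \<in> borel \<rightarrow>\<^sub>M prob_algebra borel" if "t < T" for t
    using lam_pos riccati_step.pos_def_H[OF step[OF that]]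
    by (intro measurable_gaussian pos_def_scaleR pos_def_matrix_inv) measurable

  have dens: "?Q t x = density (?R t x) (\<lambda>u. ennreal (exp ((V t x - ?C t x u - V (Suc t) (?f t x u)) / lam)))"
    if "t < T" for t x
  proof -
    have "V t x - ?C t x u - V (Suc t) (?f t x u) = 1/2 * (x \<bullet> (\<Theta> t *v x)) + \<kappa> t - 1/2 * (x \<bullet> (M t *v x))
        - 1/2 * (?f t x u \<bullet> (\<Theta> (Suc t) *v ?f t x u))" for u
      using that by (simp add: V_def sum.atLeast_Suc_lessThan)
    then show ?thesis
      unfolding \<kappa>_def by (simp only: gaussian_riccati_step[OF lam_pos Omega_hat_pos[OF that] step[OF that]])
  qed

  let ?P = "\<lambda>Q. traj_law ?f x0 Q T"
  have "?P ?Q = density (?P ?R)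
      (\<lambda>w. ennreal (exp ((V 0 x0 - ((\<Sum>s<T. ?C s (fst w s) (snd w s)) + V T (fst w T))) / lam)))"
    by (rule traj_law_density[where T = T and f = ?f and R = ?R and Q = ?Q and C = ?C and V = V,
      OF f R Q C V dens order_refl])
  \<comment> \<open>With the terminal value equal to the terminal cost, the telescoped exponent
    contains the total cost and nothing else besides \<open>V 0 x0\<close>.\<close>
  moreover have "(\<Sum>s<T. ?C s (fst w s) (snd w s)) + V T (fst w T) = ?\<Phi> w" for w
    by (simp add: V_def Theta_T case_prod_beta)
  ultimately have PQ: "?P ?Q = density (?P ?R) (\<lambda>w. ennreal (exp ((V 0 x0 - ?\<Phi> w) / lam)))"
    by simp
  have law: "prob_space (?P Q)" "sets (?P Q) = sets (traj_space T)"
    if "\<And>t. t < T \<Longrightarrow> Q t \<in> borel \<rightarrow>\<^sub>M prob_algebra borel" for Q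
    using traj_law_prob_algebra[of T ?f Q T x0] f that by (simp_all add: space_prob_algebra)
  have lawR: "prob_space (?P ?R)" using R by (rule law(1))
  have sets_lawR: "sets (?P ?R) = sets (traj_space T)" using R by (rule law(2))
  have \<Phi>: "?\<Phi> \<in> borel_measurable (?P ?R)"
  proof -
    have "(\<lambda>w :: (nat \<Rightarrow> real ^ 'n) \<times> (nat \<Rightarrow> real ^ 'm). 1/2 * (fst w t \<bullet> (M t *v fst w t)))
        \<in> borel_measurable (traj_space T)" if "t \<le> T" for t
    proof (rule measurable_compose[OF measurable_traj_state[OF that]])
      show "(\<lambda>x. 1/2 * (x \<bullet> (M t *v x))) \<in> borel_measurable borel" by measurable
    qed
    then have "(\<lambda>w. 1/2 * (fst w t \<bullet> (M t *v fst w t))) \<in> borel_measurable (?P ?R)" if "t \<le> T" for t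
      using that by (simp only: measurable_cong_sets[OF sets_lawR refl])
    then show ?thesis
      unfolding case_prod_beta by (intro borel_measurable_add borel_measurable_sum) auto
  qed
  have nonneg: "0 \<le> ?\<Phi> w" for w
  proof -
    have "0 \<le> 1/2 * (x \<bullet> (M t *v x))" if "t \<le> T" for t x
      using M_pos[OF that, THEN pos_def_imp_pos_semidef] by (simp add: pos_semidef_def)
    then show ?thesis
      unfolding case_prod_beta by (intro add_nonneg_nonneg sum_nonneg) auto
  qed
  \<comment> \<open>The Gibbs weight has mass one because it is the density of a trajectory law;
    this identifies \<open>V 0 x0\<close> as the free energy.\<close>
  have prob: "prob_space (density (?P ?R) (\<lambda>w. ennreal (exp ((V 0 x0 - ?\<Phi> w) / lam))))"
    unfolding PQ[symmetric] using Q by (rule law(1))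
  show ?thesis
    unfolding KL_control_optimal_def
  proof safe
    show "?Q \<in> policies T" using Q by (simp add: policies_def)
    fix Q :: "nat \<Rightarrow> real ^ 'n \<Rightarrow> (real ^ 'm) measure" assume "Q \<in> policies T"
    then have Q': "Q t \<in> borel \<rightarrow>\<^sub>M prob_algebra borel" if "t < T" for t
      using that by (simp add: policies_def)
    have "ext_expectation (?P ?Q) ?\<Phi> + ereal lam * KL_div (?P ?Q) (?P ?R) = ereal (V 0 x0)"
      unfolding PQ using lam_pos lawR \<Phi> nonneg prob by (rule free_energy_gibbs)
    also have "\<dots> \<le> ext_expectation (?P Q) ?\<Phi> + ereal lam * KL_div (?P Q) (?P ?R)"
      using lam_pos lawR \<Phi> nonneg prob law(1)[OF Q']
      by (rule free_energy_ge) (simp_all add: law(2)[OF Q'] sets_lawR)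
    finally show "KL_control_objective lam ?f ?C (\<lambda>x. 1/2 * (x \<bullet> (M T *v x))) ?R x0 T ?Q
        \<le> KL_control_objective lam ?f ?C (\<lambda>x. 1/2 * (x \<bullet> (M T *v x))) ?R x0 T Q"
      by (simp only: KL_control_objective_def)
  qed
qed

end
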